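(* In the setting below, given an $\alpha_3$-approximate solution to the LBFL-P instance $\mathcal{I}^3$, one can in polynomial time find an $\alpha_2$-approximate solution to the LBFL instance $\mathcal{I}^2$, where $\alpha_2 = \left(\frac{2\beta}{2\beta-1} + \frac{2}{\beta}\right)\alpha_3$.
   Context: LBFL instance $(F,C,d,f,B)$: finite facilities $F$, clients $C$, a (pseudo)metric $d$ on $F\cup C$, costs $f_i \ge 0$, lower bounds $B_i\in\mathbb{Z}_{\ge0}$; a valid solution is $(S\subseteq F,\sigma \in S^C)$ with $|\{j:\sigma_j=i\}|\ge B_i$ for $i\in S$, of cost $\sum_{i\in S}f_i + \sum_j d(j,\sigma_j)$; an $\alpha$-approximate solution (for this or the penalty problem below) is a solution of cost at most $\alpha$ times the minimum cost. Setting: let $\mathcal{I} = (F,C,d,f,B)$ be an LBFL instance, $\beta\in(1/2,1)$, and $(S^\circ,\sigma^\circ)$ with $S^\circ\subseteq F$, $\sigma^\circ\in(S^\circ)^C$, $|\{j:\sigma^\circ_j=v\}|\ge\beta B_v$ for all $v\in S^\circ$, $\sigma^\circ_j$ a nearest point of $S^\circ$ to $j$, and cost at most $\frac{2}{1-\beta}$ times the optimum of $\mathcal{I}$; assume $|S^\circ|\ge 2$ and distinct points of $S^\circ$ are at positive distance. $d^1(i,i') = d(i,i')$, $d^1(i,j) = d(i,\sigma^\circ_j)$, $d^1(j,j') = d(\sigma^\circ_j,\sigma^\circ_{j'})$ ($i,i'\in F$, $j,j'\in C$), $f^1_i = 0$ for $i\in S^\circ$ and $f^1_i = f_i$ otherwise.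 For $v\in S^\circ$: $n_v = |\{j: \sigma^\circ_j = v\}|$, $\ell_v = d(v,S^\circ\setminus\{v\})$, $N_v = \{i\in F: d(v,i)<\ell_v/2\}$ (disjoint sets). $\phi_i = v$ if $i\in N_v$, else $\phi_i = i$. $\mathcal{I}^2 = (F,C,d^2,f^2,B)$ where $d^2(i,i') = d^1(\phi_i,\phi_{i'})$, $d^2(i,j) = d^1(\phi_i,j)$, $d^2(j,j') = d^1(j,j')$, and $f^2_i = f^1_i + \frac{2}{3} n_v d^1(v,i)$ if $i\in N_v$ for some $v\in S^\circ$, $f^2_i = f^1_i$ otherwise. The LBFL with penalty instance $\mathcal{I}^3$ has the same data; a solution is $(S\subseteq F, \sigma\in(S\cup\{\bot\})^C)$ ($\sigma_j=\bot$ means $j$ is unconnected) with $|\{j:\sigma_j = i\}|\ge B_i$ for all $i\in S$; its cost is $\mathrm{cost}_{\mathcal{I}^3}(S,\sigma) = \sum_{i\in S} f^2_i + \sum_{j:\sigma_j\ne\bot} d^2(j,\sigma_j) + \frac{2\beta-1}{2\beta^2}\sum_{v\in S^\circ: S\cap N_v=\emptyset} n_v\ell_v$. *)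

theory Defs
  imports Complex_Main "HOL-Library.FuncSet" "HOL-Computational_Algebra.Polynomial"
begin

section \<open>Facility location with lower bounds\<close>

text \<open>A point of the space is Inl i for a facility i, or Inr j for a client j.\<close>

record ('f, 'c) lbfl =
  facs :: "'f set"
  clis :: "'c set"
  dst :: "'f + 'c \<Rightarrow> 'f + 'c \<Rightarrow> real"
  fcost :: "'f \<Rightarrow> real"
  lbd :: "'f \<Rightarrow> nat"

definition pseudometric_on :: "'a set \<Rightarrow> ('a \<Rightarrow> 'a \<Rightarrow> real) \<Rightarrow> bool" where
  "pseudometric_on X d \<longleftrightarrow>
     (\<forall>x\<in>X. d x x = 0) \<and>
     (\<forall>x\<in>X. \<forall>y\<in>X. 0 \<le> d x y \<and> d x y = d y x) \<and>
     (\<forall>x\<in>X. \<forall>y\<in>X. \<forall>z\<in>X. d x z \<le> d x y + d y z)"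

definition lbfl_instance :: "('f, 'c) lbfl \<Rightarrow> bool" where
  "lbfl_instance I \<longleftrightarrow>
     finite (facs I) \<and> finite (clis I) \<and>
     pseudometric_on (facs I <+> clis I) (dst I) \<and>
     (\<forall>i\<in>facs I. 0 \<le> fcost I i)"

text \<open>Assignments are extensional functions, so that solution sets are finite.\<close>

definition lbfl_solutions :: "('f, 'c) lbfl \<Rightarrow> ('f set \<times> ('c \<Rightarrow> 'f)) set" where
  "lbfl_solutions I =
     {(S, \<sigma>). S \<subseteq> facs I \<and> \<sigma> \<in> clis I \<rightarrow>\<^sub>E S \<and>
              (\<forall>i\<in>S. card {j \<in> clis I. \<sigma> j = i} \<ge> lbd I i)}"

fun lbfl_cost :: "('f, 'c) lbfl \<Rightarrow> 'f set \<times> ('c \<Rightarrow> 'f) \<Rightarrow> real" where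
  "lbfl_cost I (S, \<sigma>) = (\<Sum>i\<in>S. fcost I i) + (\<Sum>j\<in>clis I. dst I (Inr j) (Inl (\<sigma> j)))"

definition approx_solution :: "real \<Rightarrow> 's set \<Rightarrow> ('s \<Rightarrow> real) \<Rightarrow> 's \<Rightarrow> bool" where
  "approx_solution \<alpha> Sols cst x \<longleftrightarrow> x \<in> Sols \<and> cst x \<le> \<alpha> * Min (cst ` Sols)"

section \<open>The derived instances\<close>

text \<open>Throughout, S0 and s0 are the given set of facilities and the given assignment to it.
  An instance without valid solutions has infinite optimum, hence the guard on the cost bound.\<close>

definition bicriteria_setting ::
  "('f, 'c) lbfl \<Rightarrow> real \<Rightarrow> 'f set \<Rightarrow> ('c \<Rightarrow> 'f) \<Rightarrow> bool" where
  "bicriteria_setting I \<beta> S0 s0 \<longleftrightarrow>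
     lbfl_instance I \<and> 1/2 < \<beta> \<and> \<beta> < 1 \<and>
     S0 \<subseteq> facs I \<and> s0 \<in> clis I \<rightarrow>\<^sub>E S0 \<and>
     (\<forall>v\<in>S0. real (card {j \<in> clis I. s0 j = v}) \<ge> \<beta> * real (lbd I v)) \<and>
     (\<forall>j\<in>clis I. \<forall>v\<in>S0. dst I (Inr j) (Inl (s0 j)) \<le> dst I (Inr j) (Inl v)) \<and>
     (lbfl_solutions I \<noteq> {} \<longrightarrow>
        lbfl_cost I (S0, s0) \<le> 2 / (1 - \<beta>) * Min (lbfl_cost I ` lbfl_solutions I)) \<and>
     card S0 \<ge> 2 \<and>
     (\<forall>u\<in>S0. \<forall>v\<in>S0. u \<noteq> v \<longrightarrow> 0 < dst I (Inl u) (Inl v))"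

fun d1 :: "('f, 'c) lbfl \<Rightarrow> ('c \<Rightarrow> 'f) \<Rightarrow> 'f + 'c \<Rightarrow> 'f + 'c \<Rightarrow> real" where
  "d1 I s0 (Inl i) (Inl i') = dst I (Inl i) (Inl i')"
| "d1 I s0 (Inl i) (Inr j) = dst I (Inl i) (Inl (s0 j))"
| "d1 I s0 (Inr j) (Inl i) = dst I (Inl (s0 j)) (Inl i)"
| "d1 I s0 (Inr j) (Inr j') = dst I (Inl (s0 j)) (Inl (s0 j'))"

definition f1 :: "('f, 'c) lbfl \<Rightarrow> 'f set \<Rightarrow> 'f \<Rightarrow> real" where
  "f1 I S0 i = (if i \<in> S0 then 0 else fcost I i)"

definition nclients :: "('f, 'c) lbfl \<Rightarrow> ('c \<Rightarrow> 'f) \<Rightarrow> 'f \<Rightarrow> nat" where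
  "nclients I s0 v = card {j \<in> clis I. s0 j = v}"

definition ell :: "('f, 'c) lbfl \<Rightarrow> 'f set \<Rightarrow> 'f \<Rightarrow> real" where
  "ell I S0 v = Min ((\<lambda>u. dst I (Inl v) (Inl u)) ` (S0 - {v}))"

definition nbhd :: "('f, 'c) lbfl \<Rightarrow> 'f set \<Rightarrow> 'f \<Rightarrow> 'f set" where
  "nbhd I S0 v = {i \<in> facs I. dst I (Inl v) (Inl i) < ell I S0 v / 2}"

text \<open>The sets nbhd I S0 v for v in S0 are disjoint in the setting above, so the
  descriptions below are unique.\<close>

definition phi :: "('f, 'c) lbfl \<Rightarrow> 'f set \<Rightarrow> 'f \<Rightarrow> 'f" where
  "phi I S0 i =
     (if \<exists>v\<in>S0. i \<in> nbhd I S0 v then (THE v. v \<in> S0 \<and> i \<in> nbhd I S0 v) else i)"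

fun d2 :: "('f, 'c) lbfl \<Rightarrow> 'f set \<Rightarrow> ('c \<Rightarrow> 'f) \<Rightarrow> 'f + 'c \<Rightarrow> 'f + 'c \<Rightarrow> real" where
  "d2 I S0 s0 (Inl i) (Inl i') = d1 I s0 (Inl (phi I S0 i)) (Inl (phi I S0 i'))"
| "d2 I S0 s0 (Inl i) (Inr j) = d1 I s0 (Inl (phi I S0 i)) (Inr j)"
| "d2 I S0 s0 (Inr j) (Inl i) = d1 I s0 (Inr j) (Inl (phi I S0 i))"
| "d2 I S0 s0 (Inr j) (Inr j') = d1 I s0 (Inr j) (Inr j')"

definition f2 :: "('f, 'c) lbfl \<Rightarrow> 'f set \<Rightarrow> ('c \<Rightarrow> 'f) \<Rightarrow> 'f \<Rightarrow> real" where
  "f2 I S0 s0 i =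
     (if \<exists>v\<in>S0. i \<in> nbhd I S0 v
      then let v = (THE v. v \<in> S0 \<and> i \<in> nbhd I S0 v) in
           f1 I S0 i + 2/3 * real (nclients I s0 v) * d1 I s0 (Inl v) (Inl i)
      else f1 I S0 i)"

definition inst2 :: "('f, 'c) lbfl \<Rightarrow> 'f set \<Rightarrow> ('c \<Rightarrow> 'f) \<Rightarrow> ('f, 'c) lbfl" where
  "inst2 I S0 s0 = I\<lparr>dst := d2 I S0 s0, fcost := f2 I S0 s0\<rparr>"

text \<open>In the penalty problem, None marks an unconnected client.\<close>

definition lbflp_solutions :: "('f, 'c) lbfl \<Rightarrow> ('f set \<times> ('c \<Rightarrow> 'f option)) set" where
  "lbflp_solutions I =
     {(S, \<sigma>). S \<subseteq> facs I \<and> \<sigma> \<in> clis I \<rightarrow>\<^sub>E insert None (Some ` S) \<and>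
              (\<forall>i\<in>S. card {j \<in> clis I. \<sigma> j = Some i} \<ge> lbd I i)}"

fun cost3 :: "('f, 'c) lbfl \<Rightarrow> real \<Rightarrow> 'f set \<Rightarrow> ('c \<Rightarrow> 'f) \<Rightarrow>
    'f set \<times> ('c \<Rightarrow> 'f option) \<Rightarrow> real" where
  "cost3 I \<beta> S0 s0 (S, \<sigma>) =
     (\<Sum>i\<in>S. f2 I S0 s0 i) +
     (\<Sum>j\<in>{j \<in> clis I. \<sigma> j \<noteq> None}. d2 I S0 s0 (Inr j) (Inl (the (\<sigma> j)))) +
     (2 * \<beta> - 1) / (2 * \<beta>\<^sup>2) *
       (\<Sum>v\<in>{v \<in> S0. S \<inter> nbhd I S0 v = {}}. real (nclients I s0 v) * ell I S0 v)"

section \<open>A machine model\<close>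

text \<open>
  A first-order call-by-value functional language on binary trees whose leaves may carry real
  numbers, with a step count. Every construct costs one step. The only arithmetic is addition,
  subtraction and comparison, with integer literals. On inputs whose numbers are rationals,
  t steps can only produce integer combinations of input numbers and 1 with coefficients of
  bit length O(t), and trees are shared, so a number of steps polynomial in the number of
  input cells implies polynomial time on a Turing machine with numbers written in binary
  (there is no multiplication, hence no repeated squaring). On real inputs it means
  polynomially many elementary operations.
\<close>

datatype val = Leaf | Num real | Node val val

datatype expr =
    Var nat
  | Lit int
  | MkLeaf
  | MkNode expr expr
  | First expr
  | Second expr
  | Add expr expr
  | Sub expr expr
  | Less expr expr
  | Cond expr expr expr
  | Bind expr expr
  | Call nat "expr list"

text \<open>A program is a list of function bodies. Environments are lists of values addressed by de
  Bruijn indices; Bind pushes a value, Call k passes its arguments to body k. The basic operations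
  are total: projections of leaves yield Leaf, non-numbers count as 0, and Leaf is the only
  false value.\<close>

type_synonym prog = "expr list"

fun first :: "val \<Rightarrow> val" where
  "first (Node a b) = a"
| "first _ = Leaf"

fun second :: "val \<Rightarrow> val" where
  "second (Node a b) = b"
| "second _ = Leaf"

fun num :: "val \<Rightarrow> real" where
  "num (Num r) = r"
| "num _ = 0"

definition lookup :: "val list \<Rightarrow> nat \<Rightarrow> val" where
  "lookup \<rho> k = (if k < length \<rho> then \<rho> ! k else Leaf)"

inductive evals :: "prog \<Rightarrow> val list \<Rightarrow> expr \<Rightarrow> val \<Rightarrow> nat \<Rightarrow> bool"
  and evals_list :: "prog \<Rightarrow> val list \<Rightarrow> expr list \<Rightarrow> val list \<Rightarrow> nat \<Rightarrow> bool"
  for P :: prog where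
  ev_Var: "evals P \<rho> (Var k) (lookup \<rho> k) 1"
| ev_Lit: "evals P \<rho> (Lit z) (Num (of_int z)) 1"
| ev_MkLeaf: "evals P \<rho> MkLeaf Leaf 1"
| ev_MkNode: "\<lbrakk>evals P \<rho> a v s; evals P \<rho> b w t\<rbrakk> \<Longrightarrow> evals P \<rho> (MkNode a b) (Node v w) (s + t + 1)"
| ev_First: "evals P \<rho> a v t \<Longrightarrow> evals P \<rho> (First a) (first v) (t + 1)"
| ev_Second: "evals P \<rho> a v t \<Longrightarrow> evals P \<rho> (Second a) (second v) (t + 1)"
| ev_Add: "\<lbrakk>evals P \<rho> a v s; evals P \<rho> b w t\<rbrakk> \<Longrightarrow>
    evals P \<rho> (Add a b) (Num (num v + num w)) (s + t + 1)"
| ev_Sub: "\<lbrakk>evals P \<rho> a v s; evals P \<rho> b w t\<rbrakk> \<Longrightarrow>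
    evals P \<rho> (Sub a b) (Num (num v - num w)) (s + t + 1)"
| ev_Less: "\<lbrakk>evals P \<rho> a v s; evals P \<rho> b w t\<rbrakk> \<Longrightarrow>
    evals P \<rho> (Less a b) (if num v < num w then Num 1 else Leaf) (s + t + 1)"
| ev_Cond_true: "\<lbrakk>evals P \<rho> c u s; u \<noteq> Leaf; evals P \<rho> a v t\<rbrakk> \<Longrightarrow>
    evals P \<rho> (Cond c a b) v (s + t + 1)"
| ev_Cond_false: "\<lbrakk>evals P \<rho> c Leaf s; evals P \<rho> b v t\<rbrakk> \<Longrightarrow>
    evals P \<rho> (Cond c a b) v (s + t + 1)"
| ev_Bind: "\<lbrakk>evals P \<rho> a v s; evals P (v # \<rho>) b w t\<rbrakk> \<Longrightarrow>
    evals P \<rho> (Bind a b) w (s + t + 1)"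
| ev_Call: "\<lbrakk>k < length P; evals_list P \<rho> es vs s; evals P vs (P ! k) w t\<rbrakk> \<Longrightarrow>
    evals P \<rho> (Call k es) w (s + t + 1)"
| ev_Nil: "evals_list P \<rho> [] [] 0"
| ev_Cons: "\<lbrakk>evals P \<rho> e v s; evals_list P \<rho> es vs t\<rbrakk> \<Longrightarrow>
    evals_list P \<rho> (e # es) (v # vs) (s + t)"

inductive_cases evals_exprE:
  "evals P \<rho> (Var k) v t" "evals P \<rho> (Lit z) v t" "evals P \<rho> MkLeaf v t"
  "evals P \<rho> (MkNode a b) v t" "evals P \<rho> (First a) v t" "evals P \<rho> (Second a) v t"
  "evals P \<rho> (Add a b) v t" "evals P \<rho> (Sub a b) v t" "evals P \<rho> (Less a b) v t"
  "evals P \<rho> (Cond c a b) v t" "evals P \<rho> (Bind a b) v t" "evals P \<rho> (Call k es) v t"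
  "evals_list P \<rho> [] vs t" "evals_list P \<rho> (e # es) vs t"

lemma evals_deterministic:
  "evals P \<rho> e v t \<Longrightarrow> evals P \<rho> e v' t' \<Longrightarrow> v = v' \<and> t = t'"
  "evals_list P \<rho> es vs t \<Longrightarrow> evals_list P \<rho> es vs' t' \<Longrightarrow> vs = vs' \<and> t = t'"
  by (induction arbitrary: v' t' and vs' t' rule: evals_evals_list.inducts)
    (erule evals_exprE; metis One_nat_def Suc_eq_plus1)+

text \<open>The program P, started with its body 0 on input x, returns v after t steps.\<close>

definition runs :: "prog \<Rightarrow> val \<Rightarrow> val \<Rightarrow> nat \<Rightarrow> bool" where
  "runs P x v t \<longleftrightarrow> P \<noteq> [] \<and> evals P [x] (P ! 0) v t"

fun cells :: "val \<Rightarrow> nat" where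
  "cells (Node a b) = cells a + cells b + 1"
| "cells _ = 1"

section \<open>Encodings\<close>

fun enc_list :: "val list \<Rightarrow> val" where
  "enc_list [] = Leaf"
| "enc_list (v # vs) = Node v (enc_list vs)"

definition enc_nat :: "nat \<Rightarrow> val" where
  "enc_nat n = Num (of_nat n)"

fun enc_option :: "nat option \<Rightarrow> val" where
  "enc_option None = Leaf"
| "enc_option (Some n) = enc_nat n"

definition enc_set :: "nat set \<Rightarrow> val" where
  "enc_set A = enc_list (map enc_nat (sorted_list_of_set A))"

definition enc_fun :: "nat set \<Rightarrow> ('a \<Rightarrow> val) \<Rightarrow> (nat \<Rightarrow> 'a) \<Rightarrow> val" where
  "enc_fun A enc g = enc_list (map (\<lambda>a. enc (g a)) (sorted_list_of_set A))"

definition points :: "(nat, nat) lbfl \<Rightarrow> (nat + nat) list" where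
  "points I = map Inl (sorted_list_of_set (facs I)) @ map Inr (sorted_list_of_set (clis I))"

definition enc_lbfl :: "(nat, nat) lbfl \<Rightarrow> val" where
  "enc_lbfl I = enc_list
     [enc_set (facs I),
      enc_set (clis I),
      enc_list (map (\<lambda>x. enc_list (map (\<lambda>y. Num (dst I x y)) (points I))) (points I)),
      enc_fun (facs I) Num (fcost I),
      enc_fun (facs I) enc_nat (lbd I)]"

definition enc_input ::
  "(nat, nat) lbfl \<Rightarrow> real \<Rightarrow> nat set \<Rightarrow> (nat \<Rightarrow> nat) \<Rightarrow> nat set \<Rightarrow> (nat \<Rightarrow> nat option) \<Rightarrow> val" where
  "enc_input I \<beta> S0 s0 S \<sigma> = enc_list
     [enc_lbfl I, Num \<beta>,
      enc_set S0, enc_fun (clis I) enc_nat s0,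
      enc_set S, enc_fun (clis I) enc_option \<sigma>]"

definition enc_solution :: "(nat, nat) lbfl \<Rightarrow> nat set \<Rightarrow> (nat \<Rightarrow> nat) \<Rightarrow> val" where
  "enc_solution I S \<sigma> = enc_list [enc_set S, enc_fun (clis I) enc_nat \<sigma>]"

end

theory Submission
  imports Defs "HOL-Library.Product_Lexorder"
begin

text \<open>
  Put X = 2 \<beta> / (2 \<beta> - 1). In a solution of the second instance, the clients at a facility v
  with no open facility in its neighbourhood each travel at least half of ell v, so the optimum of
  the penalty problem is at most 1 + (2 \<beta> - 1) / \<beta>^2 times the optimum of the second instance.
  Since X (1 + (2 \<beta> - 1) / \<beta>^2) = X + 2 / \<beta>, it suffices to turn a solution of the penalty
  problem into one of the second instance whose cost is at most X times as large. The factor X turns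
  the penalty of v into n_v ell v / \<beta>, which is at least B_v ell v: this pays for moving fewer than
  B_v clients from v to the nearest other facility nx v.

  The unconnected clients start at s0 j. The facilities are processed by decreasing key
  (ell v, v + nx v), ties in nx being broken by the least index; the key decreases along nx except on
  the edges whose ends are nearest to each other. If S meets the neighbourhood of v, the clients
  gathered at v connect there for free; if there are at least B_v of them, v is opened for free;
  otherwise they move to nx v. An edge {v, nx v} on which this stops has fewer than min B_v B_(nx v)
  unconnected clients at both ends together, hence at least (2 \<beta> - 1) min B_v B_(nx v) connected
  ones, and (X - 1) times their connection cost, together with the unused budgets of the two ends,
  pays for sending the clients of each end to its nearest facility in S.
\<close>

section \<open>Values and step counts of programs\<close>

text \<open>The value of an expression as a total function, with \<open>F\<close> interpreting the
  calls. It turns the relation \<open>evals\<close> into equations that can be used for rewriting;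
  \<open>steps\<close> does the same for the step count.\<close>

fun den :: "(nat \<Rightarrow> val list \<Rightarrow> val) \<Rightarrow> val list \<Rightarrow> expr \<Rightarrow> val" where
  "den F \<rho> (Var k) = lookup \<rho> k"
| "den F \<rho> (Lit z) = Num (of_int z)"
| "den F \<rho> MkLeaf = Leaf"
| "den F \<rho> (MkNode a b) = Node (den F \<rho> a) (den F \<rho> b)"
| "den F \<rho> (First a) = first (den F \<rho> a)"
| "den F \<rho> (Second a) = second (den F \<rho> a)"
| "den F \<rho> (Add a b) = Num (num (den F \<rho> a) + num (den F \<rho> b))"
| "den F \<rho> (Sub a b) = Num (num (den F \<rho> a) - num (den F \<rho> b))"
| "den F \<rho> (Less a b) = (if num (den F \<rho> a) < num (den F \<rho> b) then Num 1 else Leaf)"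
| "den F \<rho> (Cond c a b) = (if den F \<rho> c \<noteq> Leaf then den F \<rho> a else den F \<rho> b)"
| "den F \<rho> (Bind a b) = den F (den F \<rho> a # \<rho>) b"
| "den F \<rho> (Call k es) = F k (map (den F \<rho>) es)"

fun steps :: "(nat \<Rightarrow> val list \<Rightarrow> val) \<Rightarrow> (nat \<Rightarrow> val list \<Rightarrow> nat) \<Rightarrow> val list \<Rightarrow> expr \<Rightarrow> nat" where
  "steps F G \<rho> (Var k) = 1"
| "steps F G \<rho> (Lit z) = 1"
| "steps F G \<rho> MkLeaf = 1"
| "steps F G \<rho> (MkNode a b) = steps F G \<rho> a + steps F G \<rho> b + 1"
| "steps F G \<rho> (First a) = steps F G \<rho> a + 1"
| "steps F G \<rho> (Second a) = steps F G \<rho> a + 1"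
| "steps F G \<rho> (Add a b) = steps F G \<rho> a + steps F G \<rho> b + 1"
| "steps F G \<rho> (Sub a b) = steps F G \<rho> a + steps F G \<rho> b + 1"
| "steps F G \<rho> (Less a b) = steps F G \<rho> a + steps F G \<rho> b + 1"
| "steps F G \<rho> (Cond c a b) =
     steps F G \<rho> c + (if den F \<rho> c \<noteq> Leaf then steps F G \<rho> a else steps F G \<rho> b) + 1"
| "steps F G \<rho> (Bind a b) = steps F G \<rho> a + steps F G (den F \<rho> a # \<rho>) b + 1"
| "steps F G \<rho> (Call k es) =
     sum_list (map (steps F G \<rho>) es) + G k (map (den F \<rho>) es) + 1"

fun callees :: "expr \<Rightarrow> nat set" where
  "callees (MkNode a b) = callees a \<union> callees b"
| "callees (First a) = callees a"
| "callees (Second a) = callees a"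
| "callees (Add a b) = callees a \<union> callees b"
| "callees (Sub a b) = callees a \<union> callees b"
| "callees (Less a b) = callees a \<union> callees b"
| "callees (Cond c a b) = callees c \<union> callees a \<union> callees b"
| "callees (Bind a b) = callees a \<union> callees b"
| "callees (Call k es) = insert k (\<Union> (set (map callees es)))"
| "callees _ = {}"

section \<open>Termination from the order of calls\<close>

definition terminates :: "prog \<Rightarrow> nat \<Rightarrow> bool" where
  "terminates P k \<longleftrightarrow> k < length P \<and> (\<forall>\<rho>. \<exists>v t. evals P \<rho> (P ! k) v t)"

text \<open>Evaluation is deterministic, so this choice and the one in \<open>fcst\<close> pick the
  only value and the only step count whenever function \<open>k\<close> terminates on
  \<open>\<rho>\<close>.\<close>

definition fval :: "prog \<Rightarrow> nat \<Rightarrow> val list \<Rightarrow> val" where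
  "fval P k \<rho> = (SOME v. \<exists>t. evals P \<rho> (P ! k) v t)"

definition fcst :: "prog \<Rightarrow> nat \<Rightarrow> val list \<Rightarrow> nat" where
  "fcst P k \<rho> = (SOME t. \<exists>v. evals P \<rho> (P ! k) v t)"

lemma fval_fcst:
  assumes "evals P \<rho> (P ! k) v t"
  shows "fval P k \<rho> = v" "fcst P k \<rho> = t"
  unfolding fval_def fcst_def using assms evals_deterministic(1) by (blast intro: some_equality)+

abbreviation "fden P \<equiv> den (fval P)"
abbreviation "fsteps P \<equiv> steps (fval P) (fcst P)"

lemma evals_list_map:
  assumes "\<And>e. e \<in> set es \<Longrightarrow> evals P \<rho> e (f e) (g e)"
  shows "evals_list P \<rho> es (map f es) (sum_list (map g es))"
  using assms by (induction es) (auto intro: ev_Nil ev_Cons)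

lemma evals_fden:
  assumes "\<And>k. k \<in> callees e \<Longrightarrow> terminates P k"
  shows "evals P \<rho> e (fden P \<rho> e) (fsteps P \<rho> e)"
  using assms
proof (induction e arbitrary: \<rho>)
  case (Call k es)
  have "terminates P k" using Call by simp
  then obtain v t where vt: "k < length P" "evals P (map (fden P \<rho>) es) (P ! k) v t"
    unfolding terminates_def by blast
  have "evals_list P \<rho> es (map (fden P \<rho>) es) (sum_list (map (fsteps P \<rho>) es))"
    by (rule evals_list_map) (use Call in auto)
  from ev_Call[OF vt(1) this vt(2)] show ?case
    using fval_fcst[OF vt(2)] by simp
next
  case (Cond c a b)
  show ?case
  proof (cases "fden P \<rho> c = Leaf")
    case True
    with Cond.IH(1)[of \<rho>] Cond.prems have "evals P \<rho> c Leaf (fsteps P \<rho> c)" by simp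
    from ev_Cond_false[OF this Cond.IH(3)[of \<rho>]] True Cond.prems show ?thesis by simp
  next
    case False
    from ev_Cond_true[OF Cond.IH(1)[of \<rho>] False Cond.IH(2)[of \<rho>]] False Cond.prems
    show ?thesis by simp
  qed
next
  case (Less a b)
  from ev_Less[OF Less.IH(1)[of \<rho>] Less.IH(2)[of \<rho>]] Less.prems show ?case by simp
qed (auto intro: evals_evals_list.intros simp flip: One_nat_def)

lemma terminates_nonrec:
  assumes "k < length P" "\<And>l. l \<in> callees (P ! k) \<Longrightarrow> terminates P l"
  shows "terminates P k"
  using assms evals_fden[of "P ! k" P] unfolding terminates_def by blast

lemma call_unfold:
  assumes "terminates P k" "\<And>l. l \<in> callees (P ! k) \<Longrightarrow> terminates P l"
  shows "fval P k \<rho> = fden P \<rho> (P ! k)" "fcst P k \<rho> = fsteps P \<rho> (P ! k)"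
  using fval_fcst[OF evals_fden[of "P ! k" P \<rho>]] assms(2) by blast+

text \<open>In a loop, the first argument is the list to be traversed, and the expressions es give the
  remaining arguments of the recursive call. The step sees the result of that call as Var 0 and the
  arguments from Var 1 on.\<close>

definition loop :: "nat \<Rightarrow> expr list \<Rightarrow> expr \<Rightarrow> expr \<Rightarrow> expr" where
  "loop k es step base = Cond (Var 0) (Bind (Call k (Second (Var 0) # es)) step) base"

text \<open>The number of times a loop over the value enters its step. A \<open>Num\<close> counts
  1: it is not \<open>Leaf\<close>, and its \<open>second\<close> is \<open>Leaf\<close>.\<close>

fun spine :: "val \<Rightarrow> nat" where
  "spine (Node a b) = Suc (spine b)"
| "spine (Num r) = 1"
| "spine Leaf = 0"

lemma spine_second: "v \<noteq> Leaf \<Longrightarrow> spine (second v) < spine v"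
  by (cases v) auto

text \<open>The first argument of the recursive call is \<open>second\<close> of the current one, so
  its \<open>spine\<close> drops.\<close>

lemma terminates_loop:
  assumes "k < length P" "P ! k = loop k es step base"
    and "\<And>l. l \<in> callees step \<Longrightarrow> terminates P l" "\<And>l. l \<in> callees base \<Longrightarrow> terminates P l"
    and "\<And>e. e \<in> set es \<Longrightarrow> callees e = {}"
  shows "terminates P k"
proof -
  have "\<exists>v t. evals P \<rho> (P ! k) v t" for \<rho>
  proof (induction "spine (lookup \<rho> 0)" arbitrary: \<rho> rule: less_induct)
    case less
    show ?case
    proof (cases "lookup \<rho> 0 = Leaf")
      case True
      have "evals P \<rho> (Var 0) Leaf 1" using ev_Var[of P \<rho> 0] True by simp
      from ev_Cond_false[OF this evals_fden[OF assms(4), of base \<rho>]]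
      show ?thesis unfolding assms(2) loop_def by blast
    next
      case False
      let ?es = "Second (Var 0) # es"
      have es: "evals_list P \<rho> ?es (map (fden P \<rho>) ?es) (sum_list (map (fsteps P \<rho>) ?es))"
        by (rule evals_list_map) (rule evals_fden, use assms(5) in auto)
      have "lookup (map (fden P \<rho>) ?es) 0 = second (lookup \<rho> 0)" by (simp add: lookup_def)
      with less[of "map (fden P \<rho>) ?es"] spine_second[OF False]
      obtain v t where "evals P (map (fden P \<rho>) ?es) (P ! k) v t" by auto
      from ev_Call[OF assms(1) es this]
      obtain s where "evals P \<rho> (Call k ?es) v s" by blast
      from ev_Bind[OF this evals_fden[OF assms(3), of step]]
      obtain w s where "evals P \<rho> (Bind (Call k ?es) step) w s" by blast
      from ev_Cond_true[OF ev_Var False this]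
      show ?thesis unfolding assms(2) loop_def by blast
    qed
  qed
  then show ?thesis using assms(1) unfolding terminates_def by blast
qed

definition well_formed :: "nat \<Rightarrow> nat \<Rightarrow> expr \<Rightarrow> bool" where
  "well_formed n k b \<longleftrightarrow> callees b \<subseteq> {k<..<n} \<or>
     (\<exists>es step base. b = loop k es step base \<and> callees step \<subseteq> {k<..<n} \<and>
        callees base \<subseteq> {k<..<n} \<and> (\<forall>e\<in>set es. callees e = {}))"

text \<open>Apart from the recursive call of a loop, calls lead to larger indices, so induction on
  the distance to the end of the program applies.\<close>

lemma terminates_well_formed:
  assumes "\<And>k. k < length P \<Longrightarrow> well_formed (length P) k (P ! k)" "k < length P"
  shows "terminates P k"
  using assms(2)
proof (induction "length P - k" arbitrary: k rule: less_induct)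
  case less
  have later: "terminates P l" if "l \<in> {k<..<length P}" for l
    using less that by auto
  from assms(1)[OF less.prems] show ?case unfolding well_formed_def
  proof
    assume "callees (P ! k) \<subseteq> {k<..<length P}"
    show ?thesis
    proof (rule terminates_nonrec[OF less.prems])
      show "terminates P l" if "l \<in> callees (P ! k)" for l
        using that \<open>callees (P ! k) \<subseteq> {k<..<length P}\<close> by (auto intro: later)
    qed
  next
    assume "\<exists>es step base. P ! k = loop k es step base \<and> callees step \<subseteq> {k<..<length P} \<and>
        callees base \<subseteq> {k<..<length P} \<and> (\<forall>e\<in>set es. callees e = {})"
    then obtain es step base where b: "P ! k = loop k es step base" "callees step \<subseteq> {k<..<length P}"
        "callees base \<subseteq> {k<..<length P}" "\<forall>e\<in>set es. callees e = {}"
      by blast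
    show ?thesis
    proof (rule terminates_loop[OF less.prems b(1)])
      show "terminates P l" if "l \<in> callees step" for l using that b(2) by (auto intro: later)
      show "terminates P l" if "l \<in> callees base" for l using that b(3) by (auto intro: later)
      show "callees e = {}" if "e \<in> set es" for e using that b(4) by simp
    qed
  qed
qed

lemma callees_well_formed:
  assumes "well_formed n k b" "k < n"
  shows "callees b \<subseteq> {k..<n}"
  using assms(1) unfolding well_formed_def
proof
  assume "\<exists>es step base. b = loop k es step base \<and> callees step \<subseteq> {k<..<n} \<and>
    callees base \<subseteq> {k<..<n} \<and> (\<forall>e\<in>set es. callees e = {})"
  then obtain es step base where b: "b = loop k es step base" "callees step \<subseteq> {k<..<n}"
    "callees base \<subseteq> {k<..<n}" "\<forall>e\<in>set es. callees e = {}" by blast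
  have "callees b = insert k (callees step \<union> callees base)" using b(4) unfolding b(1) loop_def by simp
  then show ?thesis using b(2,3) assms(2) by auto
qed auto

section \<open>Bounds on step counts\<close>

fun calls :: "(nat \<Rightarrow> val list \<Rightarrow> val) \<Rightarrow> val list \<Rightarrow> expr \<Rightarrow> (nat \<times> val list) set" where
  "calls F \<rho> (MkNode a b) = calls F \<rho> a \<union> calls F \<rho> b"
| "calls F \<rho> (First a) = calls F \<rho> a"
| "calls F \<rho> (Second a) = calls F \<rho> a"
| "calls F \<rho> (Add a b) = calls F \<rho> a \<union> calls F \<rho> b"
| "calls F \<rho> (Sub a b) = calls F \<rho> a \<union> calls F \<rho> b"
| "calls F \<rho> (Less a b) = calls F \<rho> a \<union> calls F \<rho> b"
| "calls F \<rho> (Cond c a b) =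
     calls F \<rho> c \<union> (if den F \<rho> c \<noteq> Leaf then calls F \<rho> a else calls F \<rho> b)"
| "calls F \<rho> (Bind a b) = calls F \<rho> a \<union> calls F (den F \<rho> a # \<rho>) b"
| "calls F \<rho> (Call k es) =
     insert (k, map (den F \<rho>) es) (\<Union> (set (map (calls F \<rho>) es)))"
| "calls F \<rho> _ = {}"

text \<open>A bound on the number of steps of an expression that ignores which branches are taken, in
  terms of bounds H k for calls of function k.\<close>

fun cost :: "(nat \<Rightarrow> nat) \<Rightarrow> expr \<Rightarrow> nat" where
  "cost H (MkNode a b) = cost H a + cost H b + 1"
| "cost H (First a) = cost H a + 1"
| "cost H (Second a) = cost H a + 1"
| "cost H (Add a b) = cost H a + cost H b + 1"
| "cost H (Sub a b) = cost H a + cost H b + 1"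
| "cost H (Less a b) = cost H a + cost H b + 1"
| "cost H (Cond c a b) = cost H c + cost H a + cost H b + 1"
| "cost H (Bind a b) = cost H a + cost H b + 1"
| "cost H (Call k es) = sum_list (map (cost H) es) + H k + 1"
| "cost H _ = 1"

lemma steps_le_cost:
  assumes "\<forall>(l, as)\<in>calls F \<rho> e. G l as \<le> H l"
  shows "steps F G \<rho> e \<le> cost H e"
  using assms
proof (induction e arbitrary: \<rho>)
  case (Call k es)
  have "sum_list (map (steps F G \<rho>) es) \<le> sum_list (map (cost H) es)"
    by (rule sum_list_mono) (use Call in \<open>auto simp: ball_Un\<close>)
  with Call show ?case by auto
next
  case (Cond c a b)
  then have "steps F G \<rho> c \<le> cost H c" by auto
  moreover have "(if den F \<rho> c \<noteq> Leaf then steps F G \<rho> a else steps F G \<rho> b) \<le> cost H a + cost H b"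
    using Cond.IH(2,3)[of \<rho>] Cond.prems by (auto split: if_splits)
  ultimately show ?case by auto
next
  case (Bind a b)
  then have "steps F G \<rho> a \<le> cost H a" "steps F G (den F \<rho> a # \<rho>) b \<le> cost H b" by auto
  then show ?case by simp
qed (simp_all add: ball_Un add_mono)

text \<open>The cost of one round times \<open>n + 1\<close>: a list of at most \<open>n\<close>
  entries causes at most \<open>n\<close> steps and one base case. A call of \<open>k\<close> to
  itself counts 0 inside a round, because the factor already counts the rounds.\<close>

function bound :: "prog \<Rightarrow> nat \<Rightarrow> nat \<Rightarrow> nat" where
  "bound P n k =
     (if k < length P then (n + 1) * cost (\<lambda>l. if k < l then bound P n l else 0) (P ! k) else 0)"
  by auto
termination by (relation "measure (\<lambda>(P, n, k). length P - k)") auto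

declare bound.simps [simp del]

definition round_bound :: "prog \<Rightarrow> nat \<Rightarrow> nat \<Rightarrow> nat" where
  "round_bound P n k = cost (\<lambda>l. if k < l then bound P n l else 0) (P ! k)"

lemma bound_round: "k < length P \<Longrightarrow> bound P n k = (n + 1) * round_bound P n k"
  unfolding round_bound_def by (subst bound.simps) simp

text \<open>Bounds are demanded only of the calls that occur, at their actual arguments; later they
  are established for meaningful arguments only.\<close>

lemma fcst_nonrec:
  assumes "terminates P k" "\<And>l. l \<in> callees (P ! k) \<Longrightarrow> terminates P l"
    and "\<forall>(l, as)\<in>calls (fval P) \<rho> (P ! k). k < l \<and> fcst P l as \<le> bound P n l"
  shows "fcst P k \<rho> \<le> bound P n k"
proof -
  have "fcst P k \<rho> = fsteps P \<rho> (P ! k)" by (rule call_unfold) (use assms in auto)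
  also have "\<dots> \<le> round_bound P n k"
    unfolding round_bound_def by (rule steps_le_cost) (use assms(3) in auto)
  also have "\<dots> \<le> bound P n k" using assms(1) bound_round[of k P n] unfolding terminates_def by simp
  finally show ?thesis .
qed

lemma fcst_loop:
  assumes P: "P ! k = loop k es step base" "terminates P k"
      "\<And>l. l \<in> callees (P ! k) \<Longrightarrow> terminates P l"
    and es: "\<And>e. e \<in> set es \<Longrightarrow> callees e = {}" "\<And>e \<rho>. e \<in> set es \<Longrightarrow> calls (fval P) \<rho> e = {}"
  shows "\<forall>(l, as)\<in>calls (fval P) (Leaf # ps) base. k < l \<and> fcst P l as \<le> bound P n l \<Longrightarrow>
      fcst P k (Leaf # ps) \<le> round_bound P n k"
    and "\<forall>(l, as)\<in>calls (fval P) (fval P k (xs # map (fden P (Node x xs # ps)) es) # Node x xs # ps) step.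
        k < l \<and> fcst P l as \<le> bound P n l \<Longrightarrow>
      fcst P k (Node x xs # ps) \<le> round_bound P n k + fcst P k (xs # map (fden P (Node x xs # ps)) es)"
proof -
  let ?H = "\<lambda>l. if k < l then bound P n l else 0"
  have unf: "fcst P k \<rho> = fsteps P \<rho> (P ! k)" for \<rho> by (rule call_unfold[OF P(2,3)])
  \<comment> \<open>The 6 pays for the frame of the loop: \<open>Cond\<close>, its test,
    \<open>Bind\<close>, \<open>Call\<close> and the two nodes of
    \<open>Second (Var 0)\<close>.\<close>
  have rb: "round_bound P n k = cost ?H base + cost ?H step + sum_list (map (cost ?H) es) + 6"
    unfolding round_bound_def P(1) loop_def by simp
  show "fcst P k (Leaf # ps) \<le> round_bound P n k"
    if "\<forall>(l, as)\<in>calls (fval P) (Leaf # ps) base. k < l \<and> fcst P l as \<le> bound P n l"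
  proof -
    have "fsteps P (Leaf # ps) base \<le> cost ?H base" by (rule steps_le_cost) (use that in auto)
    then show ?thesis unfolding unf rb unfolding P(1) loop_def by (simp add: lookup_def)
  qed
  let ?\<rho> = "Node x xs # ps"
  let ?r = "fval P k (xs # map (fden P ?\<rho>) es)"
  show "fcst P k ?\<rho> \<le> round_bound P n k + fcst P k (xs # map (fden P ?\<rho>) es)"
    if "\<forall>(l, as)\<in>calls (fval P) (?r # ?\<rho>) step. k < l \<and> fcst P l as \<le> bound P n l"
  proof -
    have "fsteps P (?r # ?\<rho>) step \<le> cost ?H step" by (rule steps_le_cost) (use that in auto)
    moreover have "sum_list (map (fsteps P ?\<rho>) es) \<le> sum_list (map (cost ?H) es)"
      by (rule sum_list_mono, rule steps_le_cost) (simp add: es(2))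
    moreover have "fsteps P ?\<rho> (P ! k) = sum_list (map (fsteps P ?\<rho>) es)
        + fcst P k (xs # map (fden P ?\<rho>) es) + fsteps P (?r # ?\<rho>) step + 6"
      unfolding P(1) loop_def by (simp add: lookup_def)
    ultimately show ?thesis unfolding unf[of ?\<rho>] rb by linarith
  qed
qed

lemma fval_loop:
  assumes P: "P ! k = loop k es step base" "terminates P k"
      "\<And>l. l \<in> callees (P ! k) \<Longrightarrow> terminates P l"
  shows "fval P k (Leaf # ps) = fden P (Leaf # ps) base"
    and "fval P k (Node x xs # ps) =
      fden P (fval P k (xs # map (fden P (Node x xs # ps)) es) # Node x xs # ps) step"
proof -
  have unf: "fval P k \<rho> = fden P \<rho> (P ! k)" for \<rho> by (rule call_unfold[OF P(2,3)])
  show "fval P k (Leaf # ps) = fden P (Leaf # ps) base"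
    unfolding unf unfolding P(1) loop_def by (simp add: lookup_def)
  show "fval P k (Node x xs # ps) =
      fden P (fval P k (xs # map (fden P (Node x xs # ps)) es) # Node x xs # ps) step"
    unfolding unf[of "Node x xs # ps"] unfolding P(1) loop_def by (simp add: lookup_def)
qed

section \<open>Polynomial growth of the bounds\<close>

definition polynomial_bound :: "(nat \<Rightarrow> nat) \<Rightarrow> bool" where
  "polynomial_bound f \<longleftrightarrow> (\<exists>p :: nat poly. \<forall>n. f n = poly p n)"

lemma polynomial_bound_const: "polynomial_bound (\<lambda>_. c)"
  unfolding polynomial_bound_def by (rule exI[of _ "[:c:]"]) simp

lemma polynomial_bound_id: "polynomial_bound (\<lambda>n. n)"
  unfolding polynomial_bound_def by (rule exI[of _ "[:0, 1:]"]) simp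

lemma polynomial_bound_add:
  "polynomial_bound f \<Longrightarrow> polynomial_bound g \<Longrightarrow> polynomial_bound (\<lambda>n. f n + g n)"
  unfolding polynomial_bound_def by (metis poly_add)

lemma polynomial_bound_mult:
  "polynomial_bound f \<Longrightarrow> polynomial_bound g \<Longrightarrow> polynomial_bound (\<lambda>n. f n * g n)"
  unfolding polynomial_bound_def by (metis poly_mult)

lemma polynomial_bound_cost:
  assumes "\<And>l. polynomial_bound (\<lambda>n. H n l)"
  shows "polynomial_bound (\<lambda>n. cost (H n) e)"
proof (induction e)
  case (Call k es)
  then have "polynomial_bound (\<lambda>n. sum_list (map (cost (H n)) es))"
    by (induction es) (auto intro: polynomial_bound_const polynomial_bound_add)
  then show ?case
    by (auto intro!: polynomial_bound_const polynomial_bound_add assms simp del: One_nat_def add_Suc_right)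
qed (auto intro!: polynomial_bound_const polynomial_bound_add simp del: One_nat_def add_Suc_right)

text \<open>The program is fixed, so going back from its last function only finitely many sums and
  products of polynomials arise.\<close>

lemma polynomial_bound_bound: "polynomial_bound (\<lambda>n. bound P n k)"
proof (induction "length P - k" arbitrary: k rule: less_induct)
  case less
  show ?case
  proof (cases "k < length P")
    case True
    have "polynomial_bound (\<lambda>n. if k < l then bound P n l else 0)" for l
      using less True polynomial_bound_const[of 0] by (cases "k < l") auto
    then have "polynomial_bound (\<lambda>n. cost (\<lambda>l. if k < l then bound P n l else 0) (P ! k))"
      by (rule polynomial_bound_cost)
    then have "polynomial_bound (\<lambda>n. (n + 1) * cost (\<lambda>l. if k < l then bound P n l else 0) (P ! k))"
      by (intro polynomial_bound_mult polynomial_bound_add polynomial_bound_id polynomial_bound_const)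
    with True show ?thesis by (subst bound.simps) simp
  next
    case False
    then show ?thesis using polynomial_bound_const by (subst bound.simps) simp
  qed
qed

section \<open>Routing along nearest neighbours\<close>

text \<open>Later \<open>V\<close> is \<open>S0\<close>, \<open>U\<close> the set of unconnected
  clients, \<open>q0\<close> is \<open>s0\<close>, and \<open>R v\<close> says that \<open>S\<close>
  meets the neighbourhood of \<open>v\<close>. Below, \<open>v\<close> is called settled if
  \<open>R v\<close> holds or at least \<open>B v\<close> clients are at \<open>v\<close>, and the
  edge from \<open>v\<close> to \<open>nx v\<close> is called mutual if
  \<open>nx (nx v) = v\<close>.\<close>

locale routing =
  fixes V :: "'v set" and U :: "'c set" and nx :: "'v \<Rightarrow> 'v" and d :: "'v \<Rightarrow> 'v \<Rightarrow> real"
    and key :: "'v \<Rightarrow> 'k :: linorder" and B :: "'v \<Rightarrow> nat" and R :: "'v \<Rightarrow> bool" and q0 :: "'c \<Rightarrow> 'v"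
  assumes finite_V: "finite V" and finite_U: "finite U"
    and q0: "\<And>j. j \<in> U \<Longrightarrow> q0 j \<in> V"
    and nx_in: "\<And>v. v \<in> V \<Longrightarrow> nx v \<in> V" and nx_neq: "\<And>v. v \<in> V \<Longrightarrow> nx v \<noteq> v"
    and d_self: "\<And>v. v \<in> V \<Longrightarrow> d v v = 0"
    and d_nonneg: "\<And>v w. v \<in> V \<Longrightarrow> w \<in> V \<Longrightarrow> 0 \<le> d v w"
    and d_triangle: "\<And>u v w. u \<in> V \<Longrightarrow> v \<in> V \<Longrightarrow> w \<in> V \<Longrightarrow> d u w \<le> d u v + d v w"
    and key_nx: "\<And>v. v \<in> V \<Longrightarrow> nx (nx v) \<noteq> v \<Longrightarrow> key (nx v) < key v"
    and key_root: "\<And>v. v \<in> V \<Longrightarrow> nx (nx v) = v \<Longrightarrow> key (nx v) = key v"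
begin

definition cnt :: "('c \<Rightarrow> 'v) \<Rightarrow> 'v \<Rightarrow> nat" where
  "cnt q v = card {j \<in> U. q j = v}"

text \<open>Across a mutual edge, clients move only if the receiving end is settled
  afterwards.\<close>

definition ships :: "('c \<Rightarrow> 'v) \<Rightarrow> 'v \<Rightarrow> bool" where
  "ships q v \<longleftrightarrow> \<not> R v \<and> cnt q v < B v \<and>
     (nx (nx v) \<noteq> v \<or> R (nx v) \<or> B (nx v) \<le> cnt q v + cnt q (nx v))"

definition route :: "'v \<Rightarrow> ('c \<Rightarrow> 'v) \<Rightarrow> 'c \<Rightarrow> 'v" where
  "route v q = (if ships q v then (\<lambda>j. if q j = v then nx v else q j) else q)"

text \<open>The last conjunct says that the other end of a mutual edge is settled, so it does not
  ship back.\<close>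

definition emptied :: "('c \<Rightarrow> 'v) \<Rightarrow> 'v \<Rightarrow> bool" where
  "emptied q z \<longleftrightarrow> cnt q z = 0 \<and> (nx (nx z) = z \<longrightarrow> R (nx z) \<or> B (nx z) \<le> cnt q (nx z))"

text \<open>A stuck facility is one end of an edge whose ends are nearest to each other and together have
  too few clients for either of them. The last conjunct becomes available when the other end has been
  processed as well.\<close>

definition stuck :: "'v set \<Rightarrow> ('c \<Rightarrow> 'v) \<Rightarrow> 'v \<Rightarrow> bool" where
  "stuck Z q z \<longleftrightarrow> nx (nx z) = z \<and> \<not> R (nx z) \<and> cnt q z + cnt q (nx z) < B (nx z) \<and>
     cnt q0 z \<le> cnt q z \<and>
     (nx z \<in> Z \<longrightarrow> cnt q z + cnt q (nx z) < B z \<and> cnt q0 (nx z) \<le> cnt q (nx z))"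

text \<open>These facilities hold clients that must still leave; their budgets
  \<open>B z * d z (nx z)\<close> are kept for that last trip.\<close>

definition pending :: "'v set \<Rightarrow> ('c \<Rightarrow> 'v) \<Rightarrow> 'v set" where
  "pending Z q = {z \<in> Z. \<not> R z \<and> 0 < cnt q z \<and> cnt q z < B z}"

text \<open>The last conjunct is an amortised account: each processed facility without
  \<open>R\<close> brings the budget \<open>B z * d z (nx z)\<close>, which is spent when it ships
  fewer than \<open>B z\<close> clients and is still in hand while it is pending. Distances are
  taken directly from \<open>q0 j\<close>, not along the path.\<close>

definition invariant :: "'v set \<Rightarrow> ('c \<Rightarrow> 'v) \<Rightarrow> bool" where
  "invariant Z q \<longleftrightarrow>
     (\<forall>j\<in>U. q j \<in> V) \<and>
     (\<forall>z\<in>V - Z. cnt q0 z \<le> cnt q z) \<and>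
     (\<forall>z\<in>Z. R z \<or> B z \<le> cnt q z \<or> emptied q z \<or> stuck Z q z) \<and>
     (\<Sum>j\<in>U. d (q0 j) (q j)) + (\<Sum>z\<in>pending Z q. B z * d z (nx z))
       \<le> (\<Sum>z\<in>{z \<in> Z. \<not> R z}. B z * d z (nx z))"

lemma invariant_init: "invariant {} q0"
  using q0 by (auto simp: invariant_def pending_def d_self)

lemma cnt_route:
  assumes "ships q v" "v \<in> V"
  shows "cnt (route v q) v = 0" "cnt (route v q) (nx v) = cnt q v + cnt q (nx v)"
    "z \<noteq> v \<Longrightarrow> z \<noteq> nx v \<Longrightarrow> cnt (route v q) z = cnt q z"
proof -
  have "{j \<in> U. route v q j = v} = {}" using assms nx_neq by (auto simp: route_def)
  then show "cnt (route v q) v = 0" unfolding cnt_def by (metis card.empty)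
  have *: "{j \<in> U. route v q j = nx v} = {j \<in> U. q j = v} \<union> {j \<in> U. q j = nx v}"
    using assms by (auto simp: route_def)
  show "cnt (route v q) (nx v) = cnt q v + cnt q (nx v)" unfolding cnt_def *
    by (rule card_Un_disjoint) (use finite_U nx_neq[OF assms(2)] in auto)
  assume "z \<noteq> v" "z \<noteq> nx v"
  then have "{j \<in> U. route v q j = z} = {j \<in> U. q j = z}" using assms by (auto simp: route_def)
  then show "cnt (route v q) z = cnt q z" unfolding cnt_def by simp
qed

text \<open>By the order of the keys, \<open>v\<close> ships into a processed facility only across a
  mutual edge, and this settles the receiver. Hence no facility becomes pending, and the budget of
  \<open>v\<close> pays for moving fewer than \<open>B v\<close> clients.\<close>

lemma invariant_route_ships:
  assumes invariant: "invariant Z q" and v: "v \<in> V" "v \<notin> Z" and Z: "Z \<subseteq> V"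
    and key: "\<And>z. z \<in> Z \<Longrightarrow> key v \<le> key z" and sh: "ships q v"
  shows "invariant (insert v Z) (route v q)"
proof -
  let ?q = "route v q" and ?w = "\<lambda>z. B z * d z (nx z)"
  note c = cnt_route[OF sh v(1)]
  have acc: "R (nx v) \<or> B (nx v) \<le> cnt ?q (nx v)" if "nx v \<in> Z \<or> nx (nx v) = v"
    using key[of "nx v"] key_nx[OF v(1)] sh that c(2) unfolding ships_def by force
  have fine: "R z \<or> B z \<le> cnt ?q z \<or> emptied ?q z \<or> stuck (insert v Z) ?q z" if z: "z \<in> insert v Z" for z
  proof -
    consider "z = v" | "z = nx v" "z \<in> Z" | "z \<in> Z" "z \<noteq> v" "z \<noteq> nx v" using z v by blast
    then show ?thesis
    proof cases
      case 1
      then show ?thesis using acc c(1) by (auto simp: emptied_def)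
    next
      case 2
      then show ?thesis using acc by auto
    next
      case 3
      have "R z \<or> B z \<le> cnt q z \<or> emptied q z \<or> stuck Z q z"
        using invariant 3(1) unfolding invariant_def by blast
      \<comment> \<open>The count at \<open>nx z\<close> can drop only if \<open>nx z = v\<close>;
        on a mutual edge \<open>v\<close> would then be settled and would not ship.\<close>
      moreover have "emptied ?q z" if "emptied q z"
      proof -
        have "cnt q (nx z) \<le> cnt ?q (nx z)" if "nx z \<noteq> v"
          using that c(2) c(3)[of "nx z"] by (cases "nx z = nx v") auto
        then show ?thesis using that sh 3 c(3) unfolding emptied_def ships_def by fastforce
      qed
      moreover have "stuck (insert v Z) ?q z" if st: "stuck Z q z"
      proof -
        have r: "nx (nx z) = z" using st unfolding stuck_def by blast
        have 1: "nx z \<noteq> v" using r 3(3) by auto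
        \<comment> \<open>A facility shipping into a mutual edge from outside has a larger key than
          both ends, so it precedes them; but the stuck end \<open>z\<close> is already
          processed.\<close>
        have 2: "nx z \<noteq> nx v"
        proof
          assume e: "nx z = nx v"
          then have "nx (nx v) \<noteq> v" using r 3 by auto
          then have "key (nx v) < key v" by (rule key_nx[OF v(1)])
          moreover have "key (nx z) = key z" using key_root r 3 Z by blast
          ultimately show False using key[OF 3(1)] e by auto
        qed
        show ?thesis using st c(3)[OF 1 2] c(3)[OF 3(2,3)] 1 unfolding stuck_def by auto
      qed
      ultimately show ?thesis using c(3)[OF 3(2,3)] by auto
    qed
  qed
  have own: "cnt q0 z \<le> cnt ?q z" if "z \<in> V - insert v Z" for z
  proof -
    have "cnt q0 z \<le> cnt q z" using invariant that unfolding invariant_def by blast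
    then show ?thesis using that c(2) c(3)[of z] by (cases "z = nx v") auto
  qed
  have pend: "pending (insert v Z) ?q \<subseteq> pending Z q"
  proof
    fix z assume z: "z \<in> pending (insert v Z) ?q"
    then have zz: "z \<noteq> v" "z \<in> Z" using c(1) by (auto simp: pending_def)
    then have "z \<noteq> nx v" using z acc unfolding pending_def by auto
    then show "z \<in> pending Z q" using z c(3) zz unfolding pending_def by auto
  qed
  have qV: "q j \<in> V" if "j \<in> U" for j using invariant that unfolding invariant_def by blast
  have "(\<Sum>j\<in>U. d (q0 j) (?q j)) \<le> (\<Sum>j\<in>U. d (q0 j) (q j) + (if q j = v then d v (nx v) else 0))"
  proof (rule sum_mono)
    fix j assume "j \<in> U"
    then show "d (q0 j) (?q j) \<le> d (q0 j) (q j) + (if q j = v then d v (nx v) else 0)"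
      using d_triangle[of "q0 j" v "nx v"] q0[of j] v nx_in sh unfolding route_def by auto
  qed
  also have "\<dots> = (\<Sum>j\<in>U. d (q0 j) (q j)) + cnt q v * d v (nx v)"
    by (simp add: sum.distrib sum.inter_filter[OF finite_U, symmetric] cnt_def)
  also have "\<dots> \<le> (\<Sum>j\<in>U. d (q0 j) (q j)) + ?w v"
    using sh d_nonneg[OF v(1) nx_in[OF v(1)]] unfolding ships_def
    by (intro add_left_mono mult_right_mono) auto
  finally have 1: "(\<Sum>j\<in>U. d (q0 j) (?q j)) \<le> (\<Sum>j\<in>U. d (q0 j) (q j)) + ?w v" .
  have finZ: "finite Z" using Z finite_V by (rule finite_subset)
  have 2: "sum ?w (pending (insert v Z) ?q) \<le> sum ?w (pending Z q)"
    by (rule sum_mono2[OF _ pend]) (use finZ Z d_nonneg nx_in in \<open>auto simp: pending_def\<close>)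
  have "{z \<in> insert v Z. \<not> R z} = insert v {z \<in> Z. \<not> R z}" using sh unfolding ships_def by auto
  then have "sum ?w {z \<in> insert v Z. \<not> R z} = ?w v + sum ?w {z \<in> Z. \<not> R z}"
    using finZ v by simp
  with 1 2 have "(\<Sum>j\<in>U. d (q0 j) (?q j)) + sum ?w (pending (insert v Z) ?q)
      \<le> sum ?w {z \<in> insert v Z. \<not> R z}"
    using invariant unfolding invariant_def by linarith
  then show ?thesis using fine own qV v nx_in unfolding invariant_def route_def by auto
qed

text \<open>If \<open>v\<close> does not ship and is not settled, its edge is mutual and short of
  clients, so \<open>v\<close> is stuck. A pending \<open>v\<close> adds its budget to both sides of
  the account; otherwise only the right side can grow.\<close>

lemma invariant_route_stays:
  assumes invariant: "invariant Z q" and v: "v \<in> V" "v \<notin> Z" and Z: "Z \<subseteq> V" and sh: "\<not> ships q v"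
  shows "invariant (insert v Z) (route v q)"
proof -
  let ?w = "\<lambda>z. B z * d z (nx z)"
  have fine: "\<And>z. z \<in> Z \<Longrightarrow> R z \<or> B z \<le> cnt q z \<or> emptied q z \<or> stuck Z q z"
    and own: "cnt q0 v \<le> cnt q v"
    using invariant v unfolding invariant_def by auto
  have "R z \<or> B z \<le> cnt q z \<or> emptied q z \<or> stuck (insert v Z) q z" if z: "z \<in> insert v Z" for z
  proof (cases "z = v")
    case True
    have "stuck (insert v Z) q v" if "\<not> R v" "cnt q v < B v"
    proof -
      have s: "nx (nx v) = v" "\<not> R (nx v)" "cnt q v + cnt q (nx v) < B (nx v)"
        using sh that unfolding ships_def by auto
      \<comment> \<open>A processed \<open>nx v\<close> is not settled here, and not emptied either,
        since \<open>v\<close> is not settled. So it is stuck, which bounds the common count by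
        \<open>B v\<close>.\<close>
      have "cnt q v + cnt q (nx v) < B v \<and> cnt q0 (nx v) \<le> cnt q (nx v)" if n: "nx v \<in> Z"
        using fine[OF n] s \<open>\<not> R v\<close> \<open>cnt q v < B v\<close> by (auto simp: emptied_def stuck_def)
      then show ?thesis using s own nx_neq[OF v(1)] unfolding stuck_def by auto
    qed
    with True show ?thesis by force
  next
    case False
    then have "z \<in> Z" using z by simp
    moreover have "stuck (insert v Z) q z" if st: "stuck Z q z"
      using st sh own unfolding stuck_def ships_def by (cases "nx z = v") (auto simp: add.commute)
    ultimately show ?thesis using fine by blast
  qed
  moreover have "sum ?w (pending (insert v Z) q) + sum ?w {z \<in> Z. \<not> R z}
      \<le> sum ?w (pending Z q) + sum ?w {z \<in> insert v Z. \<not> R z}"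
  proof -
    have finZ: "finite Z" using Z finite_V by (rule finite_subset)
    have w: "0 \<le> ?w v" using d_nonneg v nx_in by simp
    show ?thesis
    proof (cases "v \<in> pending (insert v Z) q")
      case True
      then have "pending (insert v Z) q = insert v (pending Z q)"
        "{z \<in> insert v Z. \<not> R z} = insert v {z \<in> Z. \<not> R z}" by (auto simp: pending_def)
      moreover have "v \<notin> pending Z q" "finite (pending Z q)" using v finZ by (auto simp: pending_def)
      ultimately show ?thesis using v finZ by simp
    next
      case False
      then have "pending (insert v Z) q = pending Z q" by (auto simp: pending_def)
      moreover have "sum ?w {z \<in> Z. \<not> R z} \<le> sum ?w {z \<in> insert v Z. \<not> R z}"
        by (rule sum_mono2) (use finZ w in auto)
      ultimately show ?thesis by simp
    qed
  qed
  ultimately show ?thesis using invariant sh unfolding invariant_def route_def by auto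
qed

text \<open>\<open>foldr\<close> applies \<open>route\<close> to the last element first, so a list
  sorted by \<open>key\<close> is processed by decreasing key.\<close>

lemma invariant_foldr:
  assumes "sorted (map key vs)" "distinct vs" "set vs \<subseteq> V"
  shows "invariant (set vs) (foldr route vs q0)"
  using assms
proof (induction vs)
  case Nil
  then show ?case using invariant_init by simp
next
  case (Cons v vs)
  then show ?case
    using invariant_route_ships[of "set vs" _ v] invariant_route_stays[of "set vs" _ v]
    by (cases "ships (foldr route vs q0) v") auto
qed

end

section \<open>From the penalty problem to the second instance\<close>

text \<open>The recursion has the shape of the loops of the program, which combine the head with the
  result for the tail. The strict comparison keeps the earlier element in a tie.\<close>

fun leftmost_min :: "('a \<Rightarrow> real) \<Rightarrow> 'a list \<Rightarrow> 'a option" where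
  "leftmost_min f [] = None"
| "leftmost_min f (x # xs) =
     (case leftmost_min f xs of
        None \<Rightarrow> Some x
      | Some y \<Rightarrow> if f y < f x then Some y else Some x)"

lemma leftmost_min_eq_None [simp]: "leftmost_min f xs = None \<longleftrightarrow> xs = []"
  by (cases xs) (auto split: option.splits)

lemma leftmost_min_Some:
  assumes "leftmost_min f xs = Some y"
  shows "y \<in> set xs" "\<And>x. x \<in> set xs \<Longrightarrow> f y \<le> f x"
  using assms by (induction xs arbitrary: y) (force split: option.splits if_splits)+

lemma leftmost_min_first:
  assumes "leftmost_min f xs = Some y" "sorted xs" "x \<in> set xs" "f x = f y"
  shows "y \<le> (x :: 'a :: linorder)"
  using assms
proof (induction xs arbitrary: y)
  case (Cons a xs)
  show ?case
  proof (cases "y = a")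
    case True
    then show ?thesis using Cons.prems by auto
  next
    case False
    then have "leftmost_min f xs = Some y" "f y < f a"
      using Cons.prems(1) by (auto split: option.splits if_splits)
    then show ?thesis using Cons by auto
  qed
qed simp

text \<open>Reindexing by the involution \<open>h\<close> writes twice each sum as a sum over the
  pairs \<open>x\<close>, \<open>h x\<close>, so comparing the pairs suffices.\<close>

lemma sum_le_sum_involution:
  fixes a b :: "'a \<Rightarrow> real"
  assumes "\<And>x. x \<in> Q \<Longrightarrow> h x \<in> Q \<and> h (h x) = x"
    and "\<And>x. x \<in> Q \<Longrightarrow> a x + a (h x) \<le> b x + b (h x)"
  shows "sum a Q \<le> sum b Q"
proof -
  have h: "sum g Q = (\<Sum>x\<in>Q. g (h x))" for g :: "'a \<Rightarrow> real"
    by (rule sum.reindex_bij_witness[where i = h and j = h]) (use assms(1) in auto)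
  have "(\<Sum>x\<in>Q. a x + a (h x)) \<le> (\<Sum>x\<in>Q. b x + b (h x))" by (rule sum_mono) (rule assms(2))
  then show ?thesis using h[of a] h[of b] by (simp add: sum.distrib)
qed

lemma sum_card_fibres:
  fixes g :: "'b \<Rightarrow> real"
  assumes "finite C" "finite V"
  shows "(\<Sum>v\<in>V. card {j \<in> C. h j = v} * g v) = (\<Sum>j\<in>{j \<in> C. h j \<in> V}. g (h j))"
proof -
  have "(\<Sum>v\<in>V. card {j \<in> C. h j = v} * g v) = (\<Sum>v\<in>V. \<Sum>j\<in>{j \<in> {j \<in> C. h j \<in> V}. h j = v}. g (h j))"
    by (intro sum.cong refl) (auto simp: conj_ac cong: conj_cong intro!: arg_cong[where f = card])
  also have "\<dots> = (\<Sum>j\<in>{j \<in> C. h j \<in> V}. g (h j))"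
    by (rule sum.group) (use assms in auto)
  finally show ?thesis .
qed

section \<open>Nearest facilities, neighbourhoods and keys\<close>

locale penalty_solution =
  fixes I :: "(nat, nat) lbfl" and \<beta> :: real and S0 s0 S \<sigma>
  assumes setting: "bicriteria_setting I \<beta> S0 s0"
    and solution: "(S, \<sigma>) \<in> lbflp_solutions (inst2 I S0 s0)"
begin

abbreviation "dd v i \<equiv> dst I (Inl v) (Inl i)"
abbreviation "N \<equiv> nbhd I S0"
abbreviation "\<phi> \<equiv> phi I S0"
abbreviation "\<l> \<equiv> ell I S0"

definition unconnected :: "nat set" where "unconnected = {j \<in> clis I. \<sigma> j = None}"
definition connected :: "nat set" where "connected = {j \<in> clis I. \<sigma> j \<noteq> None}"

definition nx :: "nat \<Rightarrow> nat" where
  "nx v = the (leftmost_min (dd v) (filter (\<lambda>x. x \<noteq> v) (sorted_list_of_set S0)))"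
definition rep :: "nat \<Rightarrow> nat option" where
  "rep v = List.find (\<lambda>i. i \<in> N v) (sorted_list_of_set S)"
definition near :: "nat \<Rightarrow> nat" where
  "near v = the (leftmost_min (\<lambda>i. dd v (\<phi> i)) (sorted_list_of_set S))"
definition key :: "nat \<Rightarrow> real \<times> nat" where
  "key v = (\<l> v, v + nx v)"

lemma inst: "finite (facs I)" "finite (clis I)" "pseudometric_on (facs I <+> clis I) (dst I)"
    "\<And>i. i \<in> facs I \<Longrightarrow> 0 \<le> fcost I i"
  and \<beta>: "1/2 < \<beta>" "\<beta> < 1"
  and S0: "S0 \<subseteq> facs I" "2 \<le> card S0" and s0_PiE: "s0 \<in> clis I \<rightarrow>\<^sub>E S0"
  and lbd_le: "\<And>v. v \<in> S0 \<Longrightarrow> \<beta> * lbd I v \<le> nclients I s0 v"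
  and positive: "\<And>u v. u \<in> S0 \<Longrightarrow> v \<in> S0 \<Longrightarrow> u \<noteq> v \<Longrightarrow> 0 < dd u v"
  using setting unfolding bicriteria_setting_def lbfl_instance_def nclients_def by auto

lemma s0: "j \<in> clis I \<Longrightarrow> s0 j \<in> S0"
  using s0_PiE by auto

lemma S: "S \<subseteq> facs I" "\<sigma> \<in> clis I \<rightarrow>\<^sub>E insert None (Some ` S)"
  and S_lbd: "\<And>i. i \<in> S \<Longrightarrow> lbd I i \<le> card {j \<in> clis I. \<sigma> j = Some i}"
  using solution unfolding lbflp_solutions_def inst2_def by auto

lemma finite_S0 [simp]: "finite S0" and finite_S [simp]: "finite S"
  using inst(1) S0(1) S(1) finite_subset by auto

lemma finite_clients [simp]: "finite unconnected" "finite connected"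
  using inst(2) unfolding unconnected_def connected_def by auto

lemma connected_in: "j \<in> connected \<Longrightarrow> the (\<sigma> j) \<in> S"
  using S(2) unfolding connected_def PiE_def Pi_def by force

lemma dd: "i \<in> facs I \<Longrightarrow> dd i i = 0"
    "i \<in> facs I \<Longrightarrow> i' \<in> facs I \<Longrightarrow> 0 \<le> dd i i'"
    "i \<in> facs I \<Longrightarrow> i' \<in> facs I \<Longrightarrow> dd i i' = dd i' i"
    "i \<in> facs I \<Longrightarrow> i' \<in> facs I \<Longrightarrow> k \<in> facs I \<Longrightarrow> dd i k \<le> dd i i' + dd i' k"
  using inst(3) unfolding pseudometric_on_def by (auto simp: InlI)

lemma nx_Some:
  assumes "v \<in> S0"
  shows "leftmost_min (dd v) (filter (\<lambda>x. x \<noteq> v) (sorted_list_of_set S0)) = Some (nx v)"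
proof -
  have "\<not> S0 \<subseteq> {v}" using S0(2) card_mono[of "{v}" S0] by auto
  then have "filter (\<lambda>x. x \<noteq> v) (sorted_list_of_set S0) \<noteq> []"
    by (auto simp: filter_empty_conv)
  then show ?thesis unfolding nx_def
    by (metis leftmost_min_eq_None option.collapse)
qed

lemma nx:
  assumes "v \<in> S0"
  shows "nx v \<in> S0" "nx v \<noteq> v" "\<And>u. u \<in> S0 \<Longrightarrow> u \<noteq> v \<Longrightarrow> dd v (nx v) \<le> dd v u"
    "\<And>u. u \<in> S0 \<Longrightarrow> u \<noteq> v \<Longrightarrow> dd v u = dd v (nx v) \<Longrightarrow> nx v \<le> u"
proof -
  note m = leftmost_min_Some[OF nx_Some[OF assms]]
  show "nx v \<in> S0" "nx v \<noteq> v" using m(1) by simp_all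
  show "dd v (nx v) \<le> dd v u" if "u \<in> S0" "u \<noteq> v" for u using m(2)[of u] that by simp
  have "sorted (filter (\<lambda>x. x \<noteq> v) (sorted_list_of_set S0))"
    by (intro sorted_wrt_filter) simp
  then show "nx v \<le> u" if "u \<in> S0" "u \<noteq> v" "dd v u = dd v (nx v)" for u
    using leftmost_min_first[OF nx_Some[OF assms], of u] that by simp
qed

lemma ell_nx: "v \<in> S0 \<Longrightarrow> \<l> v = dd v (nx v)"
  unfolding ell_def using nx by (intro Min_eqI) auto

lemma ell: assumes "v \<in> S0" shows "0 < \<l> v" "\<And>u. u \<in> S0 \<Longrightarrow> u \<noteq> v \<Longrightarrow> \<l> v \<le> dd v u"
  using nx(1,2)[OF assms] nx(3)[OF assms] positive[OF assms] ell_nx[OF assms] by simp_all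

text \<open>A common point would put \<open>u\<close> and \<open>v\<close> at distance less than
  half of \<open>\<l> u + \<l> v\<close>, while both \<open>\<l> u\<close> and \<open>\<l> v\<close>
  are at most \<open>dd u v\<close>.\<close>

lemma nbhd_disjoint:
  assumes "u \<in> S0" "v \<in> S0" "i \<in> N u" "i \<in> N v"
  shows "u = v"
proof (rule ccontr)
  assume "u \<noteq> v"
  then have "dd u v < \<l> u / 2 + \<l> v / 2"
    using assms S0(1) dd(3,4)[of u i] dd(3)[of v i] dd(4)[of u i v] unfolding nbhd_def by fastforce
  then show False using ell(2)[of u v] ell(2)[of v u] assms \<open>u \<noteq> v\<close> S0(1) dd(3)[of u v] by auto
qed

lemma the_nbhd: "v \<in> S0 \<Longrightarrow> i \<in> N v \<Longrightarrow> (THE v. v \<in> S0 \<and> i \<in> N v) = v"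
  using nbhd_disjoint by blast

lemma phi_nbhd: "v \<in> S0 \<Longrightarrow> i \<in> N v \<Longrightarrow> \<phi> i = v"
  unfolding phi_def using the_nbhd by auto

lemma phi_other: "(\<And>v. v \<in> S0 \<Longrightarrow> i \<notin> N v) \<Longrightarrow> \<phi> i = i"
  unfolding phi_def by auto

lemma self_nbhd: "v \<in> S0 \<Longrightarrow> v \<in> N v"
  using ell(1) dd(1) S0(1) unfolding nbhd_def by auto

lemma phi_in: "i \<in> facs I \<Longrightarrow> \<phi> i \<in> facs I"
  using phi_nbhd phi_other S0(1) by (metis subsetD)

lemma f2_nonneg: "i \<in> facs I \<Longrightarrow> 0 \<le> f2 I S0 s0 i"
proof -
  assume i: "i \<in> facs I"
  have "0 \<le> f1 I S0 i" using i inst(4) unfolding f1_def by auto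
  moreover have "0 \<le> dd v i" if "v \<in> S0" for v using that S0(1) i dd(2) by auto
  ultimately show ?thesis unfolding f2_def Let_def using the_nbhd by auto
qed

lemma f2_S0: "v \<in> S0 \<Longrightarrow> f2 I S0 s0 v = 0"
  using self_nbhd the_nbhd dd(1) S0(1) unfolding f2_def Let_def f1_def by auto

text \<open>If \<open>\<l>\<close> does not drop, then \<open>v\<close> is itself nearest to
  \<open>nx v\<close>, so the tie break makes \<open>nx (nx v)\<close> smaller than
  \<open>v\<close>, and the second component of the key drops.\<close>

lemma key_nx: assumes "v \<in> S0" "nx (nx v) \<noteq> v" shows "key (nx v) < key v"
proof -
  have n: "nx v \<in> S0" "nx v \<noteq> v" using nx(1,2) assms by auto
  have s: "dd (nx v) v = dd v (nx v)" using dd(3) n assms S0(1) by auto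
  have "\<l> (nx v) \<le> \<l> v" using ell(2)[OF n(1), of v] ell_nx[OF assms(1)] n assms s by auto
  moreover have "nx (nx v) < v" if "\<l> (nx v) = \<l> v"
    using nx(4)[OF n(1), of v] that n assms s ell_nx by force
  ultimately show ?thesis by (cases "\<l> (nx v) = \<l> v") (auto simp: key_def)
qed

lemma key_root: assumes "v \<in> S0" "nx (nx v) = v" shows "key (nx v) = key v"
  using assms nx(1)[OF assms(1)] ell_nx dd(3) S0(1) unfolding key_def by auto

lemma rep_Some: "rep v = Some i \<Longrightarrow> i \<in> S \<and> i \<in> N v"
  unfolding rep_def by (metis finite_S find_Some_iff nth_mem set_sorted_list_of_set)

lemma rep_None: "rep v = None \<longleftrightarrow> S \<inter> N v = {}"
  unfolding rep_def by (auto simp: find_None_iff)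

sublocale routing S0 unconnected nx dd key "lbd I" "\<lambda>v. rep v \<noteq> None" s0
proof
  show "s0 j \<in> S0" if "j \<in> unconnected" for j using s0 that unfolding unconnected_def by auto
  show "dd u w \<le> dd u v + dd v w" if "u \<in> S0" "v \<in> S0" "w \<in> S0" for u v w
    using dd(4) that S0(1) by blast
  show "0 \<le> dd v w" "dd v v = 0" if "v \<in> S0" "w \<in> S0" for v w
    using dd(1,2) that S0(1) by blast+
qed (use nx(1,2) key_nx key_root in auto)

section \<open>The constructed solution and its cost\<close>

definition final :: "nat \<Rightarrow> nat" where
  "final = foldr route (sort_key key (sorted_list_of_set S0)) s0"

lemma invariant_final: "invariant S0 final"
proof -
  have "set (sort_key key (sorted_list_of_set S0)) = S0" by simp
  then show ?thesis unfolding final_def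
    using invariant_foldr[of "sort_key key (sorted_list_of_set S0)"] by simp
qed

text \<open>In the first two cases the last trip costs nothing, because \<open>\<phi>\<close> sends
  both the representative \<open>i\<close> and \<open>v\<close> itself to \<open>v\<close>.\<close>

definition target :: "nat \<Rightarrow> nat" where
  "target v = (case rep v of Some i \<Rightarrow> i | None \<Rightarrow> if lbd I v \<le> cnt final v then v else near v)"

definition opened :: "nat set" where
  "opened = {v \<in> S0. rep v = None \<and> lbd I v \<le> cnt final v}"

definition assignment :: "nat \<Rightarrow> nat" where
  "assignment = (\<lambda>j\<in>clis I. case \<sigma> j of Some i \<Rightarrow> i | None \<Rightarrow> target (final j))"

abbreviation "\<D> j \<equiv> dd (s0 j) (\<phi> (the (\<sigma> j)))"

lemma D_nonneg: "j \<in> connected \<Longrightarrow> 0 \<le> \<D> j"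
  using connected_in[of j] S(1) dd(2) phi_in s0 S0(1) unfolding connected_def by blast

lemma near:
  assumes "S \<noteq> {}"
  shows "near v \<in> S" "\<And>i. i \<in> S \<Longrightarrow> dd v (\<phi> (near v)) \<le> dd v (\<phi> i)"
proof -
  have "leftmost_min (\<lambda>i. dd v (\<phi> i)) (sorted_list_of_set S) = Some (near v)"
    unfolding near_def using assms by (metis finite_S leftmost_min_eq_None option.collapse sorted_list_of_set_eq_Nil_iff)
  from leftmost_min_Some[OF this]
  show "near v \<in> S" "\<And>i. i \<in> S \<Longrightarrow> dd v (\<phi> (near v)) \<le> dd v (\<phi> i)" by auto
qed

lemma final_in: "j \<in> unconnected \<Longrightarrow> final j \<in> S0"
  using invariant_final unfolding invariant_def by blast

lemma final_cost:
  "(\<Sum>j\<in>unconnected. dd (s0 j) (final j)) + (\<Sum>v\<in>pending S0 final. lbd I v * \<l> v)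
     \<le> (\<Sum>v\<in>{v \<in> S0. S \<inter> N v = {}}. lbd I v * \<l> v)"
proof -
  have "(\<Sum>z\<in>pending S0 final. lbd I z * dd z (nx z)) = (\<Sum>v\<in>pending S0 final. lbd I v * \<l> v)"
    "(\<Sum>z\<in>{z \<in> S0. \<not> rep z \<noteq> None}. lbd I z * dd z (nx z)) = (\<Sum>v\<in>{v \<in> S0. S \<inter> N v = {}}. lbd I v * \<l> v)"
    using ell_nx unfolding pending_def by (auto intro!: sum.cong simp: rep_None)
  then show ?thesis using invariant_final unfolding invariant_def by simp
qed

text \<open>The two ends of a stuck edge together keep fewer than min (B v) (B u) unconnected clients, so
  at least (2 \<beta> - 1) min (B v) (B u) clients located there are connected. Each of them certifies a
  facility of S close to both ends.\<close>

lemma pending_pair: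
  assumes v: "v \<in> pending S0 final"
  defines "u \<equiv> nx v" and "m \<equiv> min (real (lbd I v)) (real (lbd I (nx v)))"
    and "K \<equiv> {j \<in> connected. s0 j = v} \<union> {j \<in> connected. s0 j = nx v}"
  shows "nx u = v" "rep u = None" "real (cnt final v) + real (cnt final u) < m" "0 < m"
    "(2 * \<beta> - 1) * m \<le> card K"
proof -
  have v': "v \<in> S0" "rep v = None" "0 < cnt final v" "cnt final v < lbd I v"
    using v unfolding pending_def by auto
  have "rep v \<noteq> None \<or> lbd I v \<le> cnt final v \<or> emptied final v \<or> stuck S0 final v"
    using invariant_final v'(1) unfolding invariant_def by blast
  then have st: "stuck S0 final v" using v' unfolding emptied_def by simp
  have u: "u \<in> S0" "u \<noteq> v" using nx(1,2)[OF v'(1)] unfolding u_def by simp_all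
  from st show uv: "nx u = v" "rep u = None" unfolding stuck_def u_def by simp_all
  have "cnt final v + cnt final u < lbd I v" "cnt final v + cnt final u < lbd I u"
    using st u(1) unfolding stuck_def u_def by simp_all
  then show w: "real (cnt final v) + real (cnt final u) < m"
    unfolding m_def u_def of_nat_add[symmetric] by simp
  have own: "cnt s0 v + cnt s0 u \<le> cnt final v + cnt final u"
    using st u(1) unfolding stuck_def u_def by simp
  show "0 < m" using w by simp
  have split: "nclients I s0 x = card {j \<in> connected. s0 j = x} + cnt s0 x" for x
  proof -
    have "{j \<in> clis I. s0 j = x} = {j \<in> connected. s0 j = x} \<union> {j \<in> unconnected. s0 j = x}"
      unfolding connected_def unconnected_def by auto
    moreover have "connected \<inter> unconnected = {}" unfolding connected_def unconnected_def by auto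
    ultimately show ?thesis unfolding nclients_def cnt_def
      using card_Un_disjoint[of "{j \<in> connected. s0 j = x}" "{j \<in> unconnected. s0 j = x}"] by auto
  qed
  have cK: "card K = card {j \<in> connected. s0 j = v} + card {j \<in> connected. s0 j = u}"
    unfolding K_def u_def[symmetric] by (rule card_Un_disjoint) (use u in auto)
  have "\<beta> * m + \<beta> * m \<le> \<beta> * lbd I v + \<beta> * lbd I u"
    unfolding m_def u_def using \<beta> by (intro add_mono mult_left_mono) auto
  also have "\<dots> \<le> nclients I s0 v + nclients I s0 u" using lbd_le[OF v'(1)] lbd_le[OF u(1)] by simp
  also have "\<dots> = real (card K) + real (cnt s0 v + cnt s0 u)" using cK split by simp
  also have "\<dots> \<le> real (card K) + m" using own w by linarith
  finally show "(2 * \<beta> - 1) * m \<le> card K" by (simp add: algebra_simps)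
qed

text \<open>A connected client \<open>j\<close> at \<open>v\<close> or \<open>nx v\<close> shows
  that some facility of \<open>S\<close> is within \<open>\<l> v + \<D> j\<close> of
  \<open>v\<close>, as \<open>s0 j\<close> is at distance at most \<open>\<l> v\<close>. Summing
  over these clients, whose number \<open>pending_pair\<close> bounds from below, gives the
  estimate; that number being positive, \<open>S\<close> is not empty.\<close>

lemma near_bound:
  assumes v: "v \<in> pending S0 final"
  shows "S \<noteq> {}"
    and "(dd v (\<phi> (near v)) - \<l> v) * ((2 * \<beta> - 1) * min (real (lbd I v)) (real (lbd I (nx v))))
      \<le> (\<Sum>j\<in>{j \<in> connected. s0 j = v}. \<D> j) + (\<Sum>j\<in>{j \<in> connected. s0 j = nx v}. \<D> j)"
proof -
  let ?K = "{j \<in> connected. s0 j = v} \<union> {j \<in> connected. s0 j = nx v}"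
  note p = pending_pair[OF v]
  have v': "v \<in> S0" using v unfolding pending_def by auto
  have "0 < real (card ?K)" using p(5) mult_pos_pos[OF _ p(4), of "2 * \<beta> - 1"] \<beta> by linarith
  then have "?K \<noteq> {}" by fastforce
  then show ne: "S \<noteq> {}" using connected_in by blast
  have each: "dd v (\<phi> (near v)) - \<l> v \<le> \<D> j" if j: "j \<in> ?K" for j
  proof -
    have jS: "the (\<sigma> j) \<in> S" "s0 j \<in> S0" using connected_in[of j] j v' nx(1)[OF v'] by auto
    have "dd v (\<phi> (near v)) \<le> dd v (\<phi> (the (\<sigma> j)))" by (rule near(2)[OF ne jS(1)])
    also have "\<dots> \<le> dd v (s0 j) + \<D> j"
      using dd(4)[of v "s0 j" "\<phi> (the (\<sigma> j))"] v' jS S0(1) phi_in S(1) by blast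
    also have "dd v (s0 j) \<le> \<l> v" using j ell_nx[OF v'] ell(1)[OF v'] dd(1) v' S0(1) by auto
    finally show ?thesis by simp
  qed
  have D: "0 \<le> (\<Sum>j\<in>?K. \<D> j)" using D_nonneg by (intro sum_nonneg) auto
  have "(dd v (\<phi> (near v)) - \<l> v) * ((2 * \<beta> - 1) * min (real (lbd I v)) (real (lbd I (nx v)))) \<le> (\<Sum>j\<in>?K. \<D> j)"
  proof (cases "0 \<le> dd v (\<phi> (near v)) - \<l> v")
    case True
    then have "(dd v (\<phi> (near v)) - \<l> v) * ((2 * \<beta> - 1) * min (real (lbd I v)) (real (lbd I (nx v))))
        \<le> (dd v (\<phi> (near v)) - \<l> v) * card ?K"
      using p(5) by (intro mult_left_mono) auto
    also have "\<dots> \<le> (\<Sum>j\<in>?K. \<D> j)" using sum_bounded_below[of ?K, OF each] by (simp add: mult.commute)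
    finally show ?thesis .
  next
    case False
    then have "(dd v (\<phi> (near v)) - \<l> v) * ((2 * \<beta> - 1) * min (real (lbd I v)) (real (lbd I (nx v)))) \<le> 0"
      using p(4) \<beta> by (intro mult_nonpos_nonneg) auto
    with D show ?thesis by linarith
  qed
  also have "(\<Sum>j\<in>?K. \<D> j) = (\<Sum>j\<in>{j \<in> connected. s0 j = v}. \<D> j) + (\<Sum>j\<in>{j \<in> connected. s0 j = nx v}. \<D> j)"
    by (rule sum.union_disjoint) (use nx(1,2)[OF v'] in auto)
  finally show "(dd v (\<phi> (near v)) - \<l> v) * ((2 * \<beta> - 1) * min (real (lbd I v)) (real (lbd I (nx v))))
      \<le> (\<Sum>j\<in>{j \<in> connected. s0 j = v}. \<D> j) + (\<Sum>j\<in>{j \<in> connected. s0 j = nx v}. \<D> j)" .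
qed

text \<open>Of each last trip from \<open>v\<close>, the part up to \<open>\<l> v\<close> is paid by
  the unspent budget, as fewer than \<open>lbd I v\<close> clients leave. The excess
  \<open>a\<close> is charged to the connected clients of the two ends of the edge.\<close>

lemma pending_cost:
  "(\<Sum>v\<in>pending S0 final. cnt final v * dd v (\<phi> (near v)))
     \<le> (\<Sum>v\<in>pending S0 final. lbd I v * \<l> v) + (\<Sum>j\<in>connected. \<D> j) / (2 * \<beta> - 1)"
proof -
  let ?P = "pending S0 final"
  \<comment> \<open>The other end of the edge of a pending facility is itself pending unless it
    holds no clients; adding it makes \<open>nx\<close> an involution on \<open>Q\<close>.\<close>
  define Q where "Q = ?P \<union> nx ` ?P"
  define a where "a v = (if v \<in> ?P then cnt final v * (dd v (\<phi> (near v)) - \<l> v) else 0)" for v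
  define b where "b v = (\<Sum>j\<in>{j \<in> connected. s0 j = v}. \<D> j) / (2 * \<beta> - 1)" for v
  have P: "?P \<subseteq> S0" unfolding pending_def by auto
  then have QS0: "Q \<subseteq> S0" using nx(1) unfolding Q_def by blast
  then have finQ: "finite Q" using finite_S0 by (rule finite_subset)
  have b0: "0 \<le> b v" for v unfolding b_def using D_nonneg \<beta> by (intro divide_nonneg_nonneg sum_nonneg) auto
  have inv: "nx v \<in> Q \<and> nx (nx v) = v" if "v \<in> Q" for v
  proof -
    from \<open>v \<in> Q\<close> consider "v \<in> ?P" | w where "w \<in> ?P" "v = nx w" unfolding Q_def by blast
    then show ?thesis using pending_pair(1)[of v] pending_pair(1) unfolding Q_def by cases simp_all
  qed
  have le: "a v + a (nx v) \<le> b v + b (nx v)" if v: "v \<in> ?P" for v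
  proof -
    let ?m = "min (real (lbd I v)) (real (lbd I (nx v)))" and ?D = "b v + b (nx v)"
    note p = pending_pair[OF v]
    \<comment> \<open>Both \<open>?m\<close> and \<open>?D\<close> are symmetric in the two ends, so
      each client at either end has excess at most \<open>?D / ?m\<close>; fewer than
      \<open>?m\<close> clients are there.\<close>
    have bound: "a x \<le> cnt final x * (?D / ?m)" if x: "x = v \<or> x = nx v" for x
    proof (cases "x \<in> ?P")
      case True
      have m: "min (real (lbd I x)) (real (lbd I (nx x))) = ?m"
        using x p(1) by (metis min.commute)
      have D: "b x + b (nx x) = ?D" using x p(1) by (metis add.commute)
      have "(dd x (\<phi> (near x)) - \<l> x) * ((2 * \<beta> - 1) * ?m) \<le> ?D * (2 * \<beta> - 1)"
      proof -
        have "2 * \<beta> - 1 \<noteq> 0" using \<beta> by simp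
        then have "(b x + b (nx x)) * (2 * \<beta> - 1) =
            (\<Sum>j\<in>{j \<in> connected. s0 j = x}. \<D> j) + (\<Sum>j\<in>{j \<in> connected. s0 j = nx x}. \<D> j)"
          unfolding b_def add_divide_distrib[symmetric] by (simp only: times_divide_eq_left nonzero_mult_div_cancel_right not_False_eq_True)
        then show ?thesis using near_bound(2)[OF True] unfolding m D by simp
      qed
      then have "(2 * \<beta> - 1) * ((dd x (\<phi> (near x)) - \<l> x) * ?m) \<le> (2 * \<beta> - 1) * ?D"
        by (simp only: mult_ac)
      then have "(dd x (\<phi> (near x)) - \<l> x) * ?m \<le> ?D" by (rule mult_left_le_imp_le) (use \<beta> in simp)
      then have "dd x (\<phi> (near x)) - \<l> x \<le> ?D / ?m" using p(4) by (simp only: pos_le_divide_eq)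
      then show ?thesis unfolding a_def using True by (simp only: if_True) (rule mult_left_mono, auto)
    next
      case False
      have "0 \<le> ?D / ?m" using b0[of v] b0[of "nx v"] p(4) by (intro divide_nonneg_pos) auto
      with False show ?thesis unfolding a_def by (simp only: if_False) (intro mult_nonneg_nonneg, auto)
    qed
    have "a v + a (nx v) \<le> (real (cnt final v) + real (cnt final (nx v))) * (?D / ?m)"
      using add_mono[OF bound[of v] bound[of "nx v"]] by (simp only: distrib_right simp_thms)
    also have "\<dots> \<le> ?m * (?D / ?m)"
      using p(3,4) b0[of v] b0[of "nx v"] by (intro mult_right_mono) auto
    also have "\<dots> = ?D" using p(4) by auto
    finally show ?thesis .
  qed
  have "sum a Q \<le> sum b Q"
  proof (rule sum_le_sum_involution)
    fix v assume v: "v \<in> Q"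
    show "nx v \<in> Q \<and> nx (nx v) = v" using v by (rule inv)
    from v consider "v \<in> ?P" | w where "w \<in> ?P" "v = nx w" unfolding Q_def by blast
    then show "a v + a (nx v) \<le> b v + b (nx v)"
    proof cases
      case 1
      then show ?thesis by (rule le)
    next
      case 2
      then show ?thesis using le[of w] pending_pair(1)[of w] by (simp add: add.commute)
    qed
  qed
  also have "sum b Q \<le> sum b S0" by (rule sum_mono2) (use QS0 b0 in simp_all)
  also have "sum b S0 = (\<Sum>j\<in>connected. \<D> j) / (2 * \<beta> - 1)"
  proof -
    have "s0 ` connected \<subseteq> S0" using s0 unfolding connected_def by blast
    from sum.group[OF finite_clients(2) finite_S0 this, of \<D>]
    show ?thesis unfolding b_def sum_divide_distrib[symmetric] by (simp only:)
  qed
  finally have 1: "sum a Q \<le> (\<Sum>j\<in>connected. \<D> j) / (2 * \<beta> - 1)" .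
  have "(\<Sum>v\<in>?P. cnt final v * dd v (\<phi> (near v))) \<le> (\<Sum>v\<in>?P. lbd I v * \<l> v + a v)"
  proof (rule sum_mono)
    fix v assume v: "v \<in> ?P"
    then have "cnt final v * \<l> v \<le> lbd I v * \<l> v"
      using ell(1)[of v] unfolding pending_def by (intro mult_right_mono) auto
    then show "cnt final v * dd v (\<phi> (near v)) \<le> lbd I v * \<l> v + a v"
      using v unfolding a_def by (simp add: algebra_simps)
  qed
  moreover have "sum a Q = sum a ?P" unfolding a_def
    by (rule sum.mono_neutral_right) (use finQ in \<open>auto simp: Q_def\<close>)
  ultimately show ?thesis using 1 by (simp add: sum.distrib)
qed

lemma target_in: "j \<in> unconnected \<Longrightarrow> target (final j) \<in> S \<union> opened"
  and target_cost: "j \<in> unconnected \<Longrightarrow> dd (final j) (\<phi> (target (final j))) =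
    (if final j \<in> pending S0 final then dd (final j) (\<phi> (near (final j))) else 0)"
proof -
  assume j: "j \<in> unconnected"
  let ?x = "final j"
  \<comment> \<open>The client \<open>j\<close> is itself counted at \<open>final j\<close>, so this
    facility is pending if it has neither a representative nor enough clients.\<close>
  have x: "?x \<in> S0" "0 < cnt final ?x"
    using final_in[OF j] j unfolding cnt_def by (auto simp: card_gt_0_iff)
  have pend: "?x \<in> pending S0 final \<longleftrightarrow> rep ?x = None \<and> cnt final ?x < lbd I ?x"
    using x unfolding pending_def by auto
  have z: "dd ?x ?x = 0" using x dd(1) S0(1) by auto
  show "target ?x \<in> S \<union> opened"
  proof (cases "rep ?x")
    case None
    then show ?thesis using pend near(1)[OF near_bound(1), of ?x ?x] x(1)
      unfolding target_def opened_def by (cases "lbd I ?x \<le> cnt final ?x") simp_all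
  next
    case (Some i)
    then show ?thesis using rep_Some[of ?x i] unfolding target_def by simp
  qed
  show "dd ?x (\<phi> (target ?x)) = (if ?x \<in> pending S0 final then dd ?x (\<phi> (near ?x)) else 0)"
  proof (cases "rep ?x")
    case None
    then show ?thesis using pend phi_nbhd[OF x(1) self_nbhd[OF x(1)]] z unfolding target_def by simp
  next
    case (Some i)
    then show ?thesis using pend rep_Some[of ?x i] phi_nbhd[OF x(1), of i] z unfolding target_def by simp
  qed
qed

lemma opened_disjoint: "S \<inter> opened = {}"
  unfolding opened_def using rep_None self_nbhd by blast

text \<open>The lower bounds hold on \<open>S\<close> because connected clients are not moved, and
  on \<open>opened\<close> because all clients that stopped at such a facility stay there.\<close>

lemma valid: "(S \<union> opened, assignment) \<in> lbfl_solutions (inst2 I S0 s0)"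
proof -
  have "assignment j \<in> S \<union> opened" if "j \<in> clis I" for j
    using that target_in[of j] connected_in[of j] unfolding assignment_def unconnected_def connected_def
    by (auto split: option.splits)
  then have "assignment \<in> clis I \<rightarrow>\<^sub>E S \<union> opened" by (auto simp: assignment_def)
  moreover have "lbd I i \<le> card {j \<in> clis I. assignment j = i}" if i: "i \<in> S \<union> opened" for i
  proof -
    consider "i \<in> S" | "i \<in> opened" using i by blast
    then obtain X where X: "X \<subseteq> {j \<in> clis I. assignment j = i}" "lbd I i \<le> card X"
    proof cases
      case 1
      have "{j \<in> clis I. \<sigma> j = Some i} \<subseteq> {j \<in> clis I. assignment j = i}"
        unfolding assignment_def by auto
      with S_lbd[OF 1] that show thesis by blast
    next
      case 2
      have "{j \<in> unconnected. final j = i} \<subseteq> {j \<in> clis I. assignment j = i}"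
        using 2 unfolding assignment_def unconnected_def opened_def target_def by auto
      with 2 that show thesis unfolding opened_def cnt_def by blast
    qed
    then show ?thesis using card_mono[OF _ X(1)] inst(2) by auto
  qed
  moreover have "opened \<subseteq> facs I" using S0(1) unfolding opened_def by auto
  ultimately show ?thesis using S(1) unfolding lbfl_solutions_def inst2_def by auto
qed

lemma cost3_eq:
  "cost3 I \<beta> S0 s0 (S, \<sigma>) = (\<Sum>i\<in>S. f2 I S0 s0 i) + (\<Sum>j\<in>connected. \<D> j) +
     (2 * \<beta> - 1) / (2 * \<beta>\<^sup>2) * (\<Sum>v\<in>{v \<in> S0. S \<inter> N v = {}}. nclients I s0 v * \<l> v)"
  by (simp add: connected_def)

lemma cost_bound:
  "lbfl_cost (inst2 I S0 s0) (S \<union> opened, assignment)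
     \<le> 2 * \<beta> / (2 * \<beta> - 1) * cost3 I \<beta> S0 s0 (S, \<sigma>)"
proof -
  let ?E = "{v \<in> S0. S \<inter> N v = {}}" and ?P = "pending S0 final"
  define f D n X where "f = (\<Sum>i\<in>S. f2 I S0 s0 i)" and "D = (\<Sum>j\<in>connected. \<D> j)"
    and "n = (\<Sum>v\<in>?E. nclients I s0 v * \<l> v)" and "X = 2 * \<beta> / (2 * \<beta> - 1)"
  have fin: "finite opened" unfolding opened_def by simp
  have "(\<Sum>i\<in>S \<union> opened. f2 I S0 s0 i) = f + (\<Sum>i\<in>opened. f2 I S0 s0 i)"
    unfolding f_def by (rule sum.union_disjoint) (use opened_disjoint fin in auto)
  moreover have "(\<Sum>i\<in>opened. f2 I S0 s0 i) = 0" using f2_S0 unfolding opened_def by auto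
  ultimately have f: "(\<Sum>i\<in>S \<union> opened. f2 I S0 s0 i) = f" by simp
  have clis: "clis I = connected \<union> unconnected" "connected \<inter> unconnected = {}"
    unfolding connected_def unconnected_def by auto
  have 1: "(\<Sum>j\<in>clis I. dd (s0 j) (\<phi> (assignment j))) =
      (\<Sum>j\<in>connected. dd (s0 j) (\<phi> (assignment j))) + (\<Sum>j\<in>unconnected. dd (s0 j) (\<phi> (assignment j)))"
    unfolding clis(1) by (rule sum.union_disjoint) (use clis(2) in auto)
  have 2: "(\<Sum>j\<in>connected. dd (s0 j) (\<phi> (assignment j))) = D"
    unfolding D_def by (rule sum.cong) (auto simp: assignment_def connected_def)
  have 3: "(\<Sum>j\<in>unconnected. dd (s0 j) (\<phi> (assignment j)))
      \<le> (\<Sum>j\<in>unconnected. dd (s0 j) (final j) + (if final j \<in> ?P then dd (final j) (\<phi> (near (final j))) else 0))"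
  proof (rule sum_mono)
    fix j assume j: "j \<in> unconnected"
    have "target (final j) \<in> facs I" using target_in[OF j] S(1) S0(1) unfolding opened_def by auto
    then have "dd (s0 j) (\<phi> (target (final j))) \<le> dd (s0 j) (final j) + dd (final j) (\<phi> (target (final j)))"
      using dd(4) phi_in final_in[OF j] q0[OF j] S0(1) by blast
    moreover have "assignment j = target (final j)"
      using j unfolding assignment_def unconnected_def by auto
    ultimately show "dd (s0 j) (\<phi> (assignment j)) \<le> dd (s0 j) (final j) +
        (if final j \<in> ?P then dd (final j) (\<phi> (near (final j))) else 0)"
      using target_cost[OF j] by simp
  qed
  have finP: "finite ?P" unfolding pending_def by simp
  have "(\<Sum>v\<in>?P. cnt final v * dd v (\<phi> (near v))) =
      (\<Sum>j\<in>{j \<in> unconnected. final j \<in> ?P}. dd (final j) (\<phi> (near (final j))))"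
    unfolding cnt_def by (rule sum_card_fibres[OF finite_clients(1) finP])
  then have 4: "(\<Sum>j\<in>unconnected. dd (s0 j) (final j) + (if final j \<in> ?P then dd (final j) (\<phi> (near (final j))) else 0))
      = (\<Sum>j\<in>unconnected. dd (s0 j) (final j)) + (\<Sum>v\<in>?P. cnt final v * dd v (\<phi> (near v)))"
    unfolding sum.distrib by (simp only: sum.inter_filter[OF finite_clients(1)])
  have "(\<Sum>v\<in>?E. lbd I v * \<l> v) \<le> (\<Sum>v\<in>?E. nclients I s0 v * \<l> v / \<beta>)"
  proof (rule sum_mono)
    fix v assume "v \<in> ?E"
    then have "\<beta> * lbd I v * \<l> v \<le> nclients I s0 v * \<l> v"
      using lbd_le[of v] ell(1)[of v] by (intro mult_right_mono) (simp_all add: less_imp_le)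
    then show "lbd I v * \<l> v \<le> nclients I s0 v * \<l> v / \<beta>"
      using \<beta> by (simp add: pos_le_divide_eq mult_ac)
  qed
  then have 5: "(\<Sum>v\<in>?E. lbd I v * \<l> v) \<le> n / \<beta>" unfolding n_def sum_divide_distrib .
  have "(\<Sum>j\<in>clis I. dd (s0 j) (\<phi> (assignment j))) \<le> D + n / \<beta> + D / (2 * \<beta> - 1)"
    using 1 2 3 4 5 final_cost pending_cost[folded D_def] by linarith
  \<comment> \<open>\<open>X\<close> equals \<open>1 + 1 / (2 * \<beta> - 1)\<close>, and its
    product with the penalty coefficient is \<open>1 / \<beta>\<close>.\<close>
  moreover have "D + n / \<beta> + D / (2 * \<beta> - 1) = X * D + X * ((2 * \<beta> - 1) / (2 * \<beta>\<^sup>2) * n)"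
  proof -
    define c where "c = 2 * \<beta> - 1"
    have c: "2 * \<beta> = c + 1" "c \<noteq> 0" "\<beta> \<noteq> 0" using \<beta> unfolding c_def by auto
    have "X * D = D + D / c" unfolding X_def c_def[symmetric] c(1) using c(2) by (simp add: field_simps)
    moreover have "X * (c / (2 * \<beta>\<^sup>2) * n) = n / \<beta>"
      unfolding X_def c_def[symmetric] using c(2,3) by (simp add: power2_eq_square)
    ultimately show ?thesis unfolding c_def by simp
  qed
  moreover have "f \<le> X * f"
  proof -
    have "0 \<le> f" unfolding f_def using f2_nonneg S(1) by (intro sum_nonneg) auto
    moreover have "1 \<le> X" using \<beta> unfolding X_def by (simp add: pos_le_divide_eq)
    ultimately show ?thesis using mult_right_mono[of 1 X f] by simp
  qed
  moreover have "lbfl_cost (inst2 I S0 s0) (S \<union> opened, assignment) =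
      (\<Sum>i\<in>S \<union> opened. f2 I S0 s0 i) + (\<Sum>j\<in>clis I. dd (s0 j) (\<phi> (assignment j)))"
    by (simp add: inst2_def)
  moreover have "cost3 I \<beta> S0 s0 (S, \<sigma>) = f + D + (2 * \<beta> - 1) / (2 * \<beta>\<^sup>2) * n"
    unfolding f_def D_def n_def by (rule cost3_eq)
  ultimately show ?thesis unfolding X_def[symmetric] f by (simp only: distrib_left)
qed

section \<open>Comparison of the two optima\<close>

lemma cost3_nonneg: "0 \<le> cost3 I \<beta> S0 s0 (S, \<sigma>)"
proof -
  have "0 \<le> (\<Sum>v\<in>{v \<in> S0. S \<inter> N v = {}}. nclients I s0 v * \<l> v)"
    using ell(1) by (intro sum_nonneg) (auto simp: less_imp_le)
  moreover have "0 \<le> (\<Sum>i\<in>S. f2 I S0 s0 i)" using f2_nonneg S(1) by (intro sum_nonneg) auto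
  moreover have "0 \<le> (\<Sum>j\<in>connected. \<D> j)" using D_nonneg by (rule sum_nonneg)
  ultimately show ?thesis unfolding cost3_eq using \<beta> by (intro add_nonneg_nonneg mult_nonneg_nonneg) auto
qed

text \<open>Either \<open>\<phi> i\<close> is another facility of \<open>S0\<close>, at distance at
  least \<open>\<l> v\<close>, or it is \<open>i\<close> itself, which lies outside the ball of
  radius \<open>\<l> v / 2\<close>.\<close>

lemma far_from_outside:
  assumes "v \<in> S0" "i \<in> facs I" "i \<notin> N v"
  shows "\<l> v / 2 \<le> dd v (\<phi> i)"
proof (cases "\<exists>u\<in>S0. i \<in> N u")
  case True
  then obtain u where u: "u \<in> S0" "i \<in> N u" by blast
  then have "\<l> v \<le> dd v (\<phi> i)" using ell(2)[OF assms(1), of u] phi_nbhd[OF u] assms by auto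
  then show ?thesis using ell(1)[OF assms(1)] by simp
next
  case False
  then show ?thesis using phi_other[of i] assms unfolding nbhd_def by auto
qed

lemma
  assumes "(T, \<tau>) \<in> lbfl_solutions (inst2 I S0 s0)"
  shows cost2_nonneg: "0 \<le> lbfl_cost (inst2 I S0 s0) (T, \<tau>)"
    and optimum_comparison: "\<exists>x\<in>lbflp_solutions (inst2 I S0 s0).
      cost3 I \<beta> S0 s0 x \<le> (1 + (2 * \<beta> - 1) / \<beta>\<^sup>2) * lbfl_cost (inst2 I S0 s0) (T, \<tau>)"
proof -
  have T: "T \<subseteq> facs I" "\<tau> \<in> clis I \<rightarrow>\<^sub>E T" "\<And>i. i \<in> T \<Longrightarrow> lbd I i \<le> card {j \<in> clis I. \<tau> j = i}"
    using assms unfolding lbfl_solutions_def inst2_def by auto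
  let ?f = "\<Sum>i\<in>T. f2 I S0 s0 i" and ?D = "\<Sum>j\<in>clis I. dd (s0 j) (\<phi> (\<tau> j))"
  let ?E = "{v \<in> S0. T \<inter> N v = {}}"
  have cost2: "lbfl_cost (inst2 I S0 s0) (T, \<tau>) = ?f + ?D" by (simp add: inst2_def)
  have f: "0 \<le> ?f" using f2_nonneg T(1) by (intro sum_nonneg) auto
  have d: "0 \<le> dd (s0 j) (\<phi> (\<tau> j))" if "j \<in> clis I" for j
    using dd(2) phi_in s0[OF that] S0(1) T(1,2) that by blast
  then have D: "0 \<le> ?D" by (rule sum_nonneg)
  from f D show "0 \<le> lbfl_cost (inst2 I S0 s0) (T, \<tau>)" unfolding cost2 by simp
  \<comment> \<open>All clients stay connected, so only the penalty is added to the cost.\<close>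
  define \<tau>' where "\<tau>' = (\<lambda>j\<in>clis I. Some (\<tau> j))"
  have "{j \<in> clis I. \<tau>' j = Some i} = {j \<in> clis I. \<tau> j = i}" for i by (auto simp: \<tau>'_def)
  then have "(T, \<tau>') \<in> lbflp_solutions (inst2 I S0 s0)"
    using T unfolding lbflp_solutions_def inst2_def by (auto simp: \<tau>'_def)
  moreover have "cost3 I \<beta> S0 s0 (T, \<tau>') \<le> (1 + (2 * \<beta> - 1) / \<beta>\<^sup>2) * (?f + ?D)"
  proof -
    have "(\<Sum>v\<in>?E. nclients I s0 v * \<l> v) = (\<Sum>j\<in>{j \<in> clis I. s0 j \<in> ?E}. \<l> (s0 j))"
      unfolding nclients_def by (rule sum_card_fibres) (use inst(2) in auto)
    also have "\<dots> \<le> (\<Sum>j\<in>{j \<in> clis I. s0 j \<in> ?E}. 2 * dd (s0 j) (\<phi> (\<tau> j)))"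
    proof (rule sum_mono)
      fix j assume j: "j \<in> {j \<in> clis I. s0 j \<in> ?E}"
      then show "\<l> (s0 j) \<le> 2 * dd (s0 j) (\<phi> (\<tau> j))"
        using far_from_outside[of "s0 j" "\<tau> j"] T(1,2) by fastforce
    qed
    also have "\<dots> \<le> (\<Sum>j\<in>clis I. 2 * dd (s0 j) (\<phi> (\<tau> j)))"
      by (rule sum_mono2) (use inst(2) d in auto)
    finally have "(\<Sum>v\<in>?E. nclients I s0 v * \<l> v) \<le> 2 * (?f + ?D)"
      using f unfolding sum_distrib_left[symmetric] by simp
    then have "(2 * \<beta> - 1) / (2 * \<beta>\<^sup>2) * (\<Sum>v\<in>?E. nclients I s0 v * \<l> v)
        \<le> (2 * \<beta> - 1) / (2 * \<beta>\<^sup>2) * (2 * (?f + ?D))"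
      using \<beta> by (intro mult_left_mono) auto
    also have "\<dots> = (2 * \<beta> - 1) / \<beta>\<^sup>2 * (?f + ?D)" using \<beta> by (simp add: field_simps)
    moreover have "cost3 I \<beta> S0 s0 (T, \<tau>') =
        ?f + ?D + (2 * \<beta> - 1) / (2 * \<beta>\<^sup>2) * (\<Sum>v\<in>?E. nclients I s0 v * \<l> v)"
      by (auto simp: \<tau>'_def intro!: sum.cong)
    ultimately show ?thesis by (simp only: distrib_right mult_1_left add_left_mono)
  qed
  ultimately show "\<exists>x\<in>lbflp_solutions (inst2 I S0 s0).
      cost3 I \<beta> S0 s0 x \<le> (1 + (2 * \<beta> - 1) / \<beta>\<^sup>2) * lbfl_cost (inst2 I S0 s0) (T, \<tau>)"
    unfolding cost2 by blast
qed

text \<open>Finiteness makes \<open>Min\<close> in \<open>approx_solution\<close> a genuine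
  minimum.\<close>

lemma finite_solutions:
  "finite (lbfl_solutions (inst2 I S0 s0))" "finite (lbflp_solutions (inst2 I S0 s0))"
proof -
  have "lbfl_solutions (inst2 I S0 s0) \<subseteq> Pow (facs I) \<times> (clis I \<rightarrow>\<^sub>E facs I)"
    unfolding lbfl_solutions_def inst2_def by (auto simp: PiE_iff extensional_def)
  then show "finite (lbfl_solutions (inst2 I S0 s0))"
    by (rule finite_subset) (use inst(1,2) in \<open>auto intro: finite_PiE\<close>)
  have "lbflp_solutions (inst2 I S0 s0) \<subseteq> Pow (facs I) \<times> (clis I \<rightarrow>\<^sub>E insert None (Some ` facs I))"
  proof
    fix x assume "x \<in> lbflp_solutions (inst2 I S0 s0)"
    then obtain T \<tau> where "x = (T, \<tau>)" "T \<subseteq> facs I" "\<tau> \<in> clis I \<rightarrow>\<^sub>E insert None (Some ` T)"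
      unfolding lbflp_solutions_def inst2_def by auto
    moreover from this have "\<tau> \<in> clis I \<rightarrow>\<^sub>E insert None (Some ` facs I)"
      using PiE_mono[of "clis I" "\<lambda>_. insert None (Some ` T)" "\<lambda>_. insert None (Some ` facs I)"] by blast
    ultimately show "x \<in> Pow (facs I) \<times> (clis I \<rightarrow>\<^sub>E insert None (Some ` facs I))" by blast
  qed
  then show "finite (lbflp_solutions (inst2 I S0 s0))"
    by (rule finite_subset) (use inst(1,2) in \<open>auto intro: finite_PiE\<close>)
qed

end

lemma approximation:
  assumes setting: "bicriteria_setting I \<beta> S0 s0"
    and approx: "approx_solution \<alpha> (lbflp_solutions (inst2 I S0 s0)) (cost3 I \<beta> S0 s0) (S, \<sigma>)"
  shows "approx_solution ((2 * \<beta> / (2 * \<beta> - 1) + 2 / \<beta>) * \<alpha>)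
    (lbfl_solutions (inst2 I S0 s0)) (lbfl_cost (inst2 I S0 s0))
    (S \<union> penalty_solution.opened I S0 s0 S \<sigma>, penalty_solution.assignment I S0 s0 S \<sigma>)"
proof -
  interpret penalty_solution I \<beta> S0 s0 S \<sigma>
    using assms by unfold_locales (auto simp: approx_solution_def)
  let ?c2 = "lbfl_cost (inst2 I S0 s0)" and ?c3 = "cost3 I \<beta> S0 s0"
  let ?L2 = "lbfl_solutions (inst2 I S0 s0)" and ?L3 = "lbflp_solutions (inst2 I S0 s0)"
  let ?x = "(S \<union> opened, assignment)"
  let ?X = "2 * \<beta> / (2 * \<beta> - 1)" and ?Y = "1 + (2 * \<beta> - 1) / \<beta>\<^sup>2"
  define m2 m3 where "m2 = Min (?c2 ` ?L2)" and "m3 = Min (?c3 ` ?L3)"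
  \<comment> \<open>By \<open>valid\<close> the second instance has a solution, so its minimum is
    attained.\<close>
  have "m2 \<in> ?c2 ` ?L2" unfolding m2_def using valid finite_solutions by (intro Min_in) auto
  then obtain T \<tau> where T: "(T, \<tau>) \<in> ?L2" "m2 = ?c2 (T, \<tau>)" by auto
  from optimum_comparison[OF T(1)] obtain x where "x \<in> ?L3" "?c3 x \<le> ?Y * m2" unfolding T(2) by blast
  then have m3: "m3 \<le> ?Y * m2" unfolding m3_def using finite_solutions by (auto intro: order_trans[OF Min_le])
  have "m3 \<in> ?c3 ` ?L3" unfolding m3_def using solution finite_solutions by (intro Min_in) auto
  then obtain S'' \<sigma>'' where "m3 = ?c3 (S'', \<sigma>'')" "(S'', \<sigma>'') \<in> ?L3" by auto
  then have m3_nonneg: "0 \<le> m3"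
    using penalty_solution.cost3_nonneg[of I \<beta> S0 s0 S'' \<sigma>''] setting by (auto simp: penalty_solution_def)
  have m2_nonneg: "0 \<le> m2" unfolding T(2) by (rule cost2_nonneg[OF T(1)])
  have c3: "?c3 (S, \<sigma>) \<le> \<alpha> * m3" using approx unfolding approx_solution_def m3_def by simp
  have XY: "?X * ?Y = ?X + 2 / \<beta>"
  proof -
    have "2 * \<beta> - 1 \<noteq> 0" "\<beta> \<noteq> 0" using \<beta> by auto
    then have "?X * ((2 * \<beta> - 1) / \<beta>\<^sup>2) = 2 / \<beta>" by (simp add: power2_eq_square)
    then show ?thesis by (simp only: distrib_left mult_1_right)
  qed
  have "?c2 ?x \<le> (?X + 2 / \<beta>) * \<alpha> * m2"
  proof (cases "0 \<le> \<alpha>")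
    case True
    have "?c2 ?x \<le> ?X * ?c3 (S, \<sigma>)" by (rule cost_bound)
    also have "\<dots> \<le> ?X * (\<alpha> * (?Y * m2))"
      using c3 mult_left_mono[OF m3 True] \<beta> by (intro mult_left_mono) auto
    also have "\<dots> = (?X * ?Y) * \<alpha> * m2" by (simp add: mult_ac)
    finally show ?thesis unfolding XY .
  next
    \<comment> \<open>For negative \<alpha>, nonnegativity of the costs forces
      \<open>?c3 (S, \<sigma>) = 0\<close>, and then \<open>cost_bound\<close> makes
      \<open>?c2 ?x\<close> and \<open>m2\<close> vanish.\<close>
    case False
    then have "?c3 (S, \<sigma>) = 0"
      using c3 cost3_nonneg m3_nonneg by (smt (verit) mult_nonpos_nonneg)
    then have "?c2 ?x \<le> 0" using cost_bound by simp
    moreover have "m2 \<le> ?c2 ?x" unfolding m2_def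
      by (rule Min_le) (use finite_solutions valid in \<open>blast intro: finite_imageI\<close>)+
    ultimately have "?c2 ?x = 0" "m2 = 0" using m2_nonneg by linarith+
    then show ?thesis by (simp only: mult_zero_right)
  qed
  then show ?thesis unfolding approx_solution_def m2_def using valid by auto
qed

section \<open>The program\<close>

lemma lookup_simps [simp]:
  "lookup (a # \<rho>) 0 = a" "lookup (a # \<rho>) (Suc n) = lookup \<rho> n"
  "lookup (a # \<rho>) (numeral m) = lookup \<rho> (pred_numeral m)"
  by (simp_all add: lookup_def numeral_eq_Suc)

abbreviation (input) "p_main \<equiv> 0 :: nat"
abbreviation (input) "p_open \<equiv> 1 :: nat"
abbreviation (input) "p_is_open \<equiv> 2 :: nat"
abbreviation (input) "p_assign \<equiv> 3 :: nat"
abbreviation (input) "p_assign_client \<equiv> 4 :: nat"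
abbreviation (input) "p_target \<equiv> 5 :: nat"
abbreviation (input) "p_near \<equiv> 6 :: nat"
abbreviation (input) "p_phi \<equiv> 7 :: nat"
abbreviation (input) "p_start \<equiv> 8 :: nat"
abbreviation (input) "p_run \<equiv> 9 :: nat"
abbreviation (input) "p_route \<equiv> 10 :: nat"
abbreviation (input) "p_ships \<equiv> 11 :: nat"
abbreviation (input) "p_move \<equiv> 12 :: nat"
abbreviation (input) "p_sort \<equiv> 13 :: nat"
abbreviation (input) "p_insert \<equiv> 14 :: nat"
abbreviation (input) "p_key_le \<equiv> 15 :: nat"
abbreviation (input) "p_rep \<equiv> 16 :: nat"
abbreviation (input) "p_find \<equiv> 17 :: nat"
abbreviation (input) "p_in \<equiv> 18 :: nat"
abbreviation (input) "p_ell \<equiv> 19 :: nat"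
abbreviation (input) "p_nx \<equiv> 20 :: nat"
abbreviation (input) "p_dist \<equiv> 21 :: nat"
abbreviation (input) "p_lbd \<equiv> 22 :: nat"
abbreviation (input) "p_count \<equiv> 23 :: nat"
abbreviation (input) "p_mem \<equiv> 24 :: nat"
abbreviation (input) "p_look \<equiv> 25 :: nat"
abbreviation (input) "p_eq \<equiv> 26 :: nat"

abbreviation "get_facs c \<equiv> First (First c)"
abbreviation "get_clis c \<equiv> First (Second (First c))"
abbreviation "get_dst c \<equiv> First (Second (Second (First c)))"
abbreviation "get_lbd c \<equiv> First (Second (Second (Second (Second (First c)))))"
abbreviation "get_S0 c \<equiv> First (Second (Second c))"
abbreviation "get_s0 c \<equiv> First (Second (Second (Second c)))"
abbreviation "get_S c \<equiv> First (Second (Second (Second (Second c))))"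
abbreviation "get_sigma c \<equiv> First (Second (Second (Second (Second (Second c)))))"

abbreviation "is_eq a b \<equiv> Call p_eq [a, b]"
abbreviation "look ks vs x \<equiv> Call p_look [ks, vs, x]"
abbreviation "dist_of v i c \<equiv> Call p_dist [v, i, c]"
abbreviation "nx_of v c \<equiv> Call p_nx [get_S0 c, v, c]"
abbreviation "phi_of i c \<equiv> Call p_phi [get_S0 c, i, c]"
abbreviation "lbd_of v c \<equiv> Call p_lbd [v, c]"
abbreviation "count_of pos v \<equiv> Call p_count [pos, v]"
abbreviation "rep_of v c \<equiv> Call p_rep [v, c]"

text \<open>Each function only calls functions of larger index, apart from the recursive calls of the loops;
  this is what makes the generic time bound well founded. In the argument lists below, c is the
  encoded input; an assignment of the unconnected clients to facilities is a list pos with one entry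
  per client, which is a leaf if the client is connected.\<close>

definition prog :: prog where
  "prog = [
    \<comment> \<open>p_main [c]\<close>
    Bind (Call p_run [Call p_sort [get_S0 (Var 0), Var 0], Call p_start [get_clis (Var 0), Var 0], Var 0])
      (MkNode (Call p_open [get_facs (Var 1), Var 0, Var 1])
        (MkNode (Call p_assign [get_clis (Var 1), Var 0, Var 1]) MkLeaf)),
    \<comment> \<open>p_open [xs, pos, c]\<close>
    loop p_open [Var 1, Var 2]
      (Cond (Call p_is_open [First (Var 1), Var 2, Var 3]) (MkNode (First (Var 1)) (Var 0)) (Var 0))
      MkLeaf,
    \<comment> \<open>p_is_open [x, pos, c]\<close>
    Cond (Call p_mem [get_S (Var 2), Var 0]) (Lit 1)
      (Cond (Call p_mem [get_S0 (Var 2), Var 0])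
        (Cond (rep_of (Var 0) (Var 2)) MkLeaf
          (Cond (Less (count_of (Var 1) (Var 0)) (lbd_of (Var 0) (Var 2))) MkLeaf (Lit 1)))
        MkLeaf),
    \<comment> \<open>p_assign [xs, pos, c]\<close>
    loop p_assign [Var 1, Var 2]
      (MkNode (Call p_assign_client [First (Var 1), Var 2, Var 3]) (Var 0))
      MkLeaf,
    \<comment> \<open>p_assign_client [j, pos, c]\<close>
    Bind (look (get_clis (Var 2)) (get_sigma (Var 2)) (Var 0))
      (Cond (Var 0) (Var 0)
        (Call p_target [look (get_clis (Var 3)) (Var 2) (Var 1), Var 2, Var 3])),
    \<comment> \<open>p_target [v, pos, c]\<close>
    Bind (rep_of (Var 0) (Var 2))
      (Cond (Var 0) (Var 0)
        (Cond (Less (count_of (Var 2) (Var 1)) (lbd_of (Var 1) (Var 3)))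
          (Call p_near [get_S (Var 3), Var 1, Var 3]) (Var 1))),
    \<comment> \<open>p_near [xs, v, c]\<close>
    loop p_near [Var 1, Var 2]
      (Cond (Var 0)
        (Cond (Less (dist_of (Var 2) (phi_of (Var 0) (Var 3)) (Var 3))
                    (dist_of (Var 2) (phi_of (First (Var 1)) (Var 3)) (Var 3)))
          (Var 0) (First (Var 1)))
        (First (Var 1)))
      MkLeaf,
    \<comment> \<open>p_phi [xs, i, c]\<close>
    loop p_phi [Var 1, Var 2]
      (Cond (Call p_in [First (Var 1), Var 2, Var 3]) (First (Var 1)) (Var 0))
      (Var 1),
    \<comment> \<open>p_start [xs, c]\<close>
    loop p_start [Var 1]
      (MkNode
        (Cond (look (get_clis (Var 2)) (get_sigma (Var 2)) (First (Var 1))) MkLeaf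
          (look (get_clis (Var 2)) (get_s0 (Var 2)) (First (Var 1))))
        (Var 0))
      MkLeaf,
    \<comment> \<open>p_run [vs, pos, c]\<close>
    loop p_run [Var 1, Var 2] (Call p_route [First (Var 1), Var 0, Var 3]) (Var 1),
    \<comment> \<open>p_route [v, pos, c]\<close>
    Cond (Call p_ships [Var 0, Var 1, Var 2])
      (Call p_move [Var 1, Var 0, nx_of (Var 0) (Var 2)]) (Var 1),
    \<comment> \<open>p_ships [v, pos, c]\<close>
    Cond (rep_of (Var 0) (Var 2)) MkLeaf
      (Cond (Less (count_of (Var 1) (Var 0)) (lbd_of (Var 0) (Var 2)))
        (Bind (nx_of (Var 0) (Var 2))
          (Cond (is_eq (nx_of (Var 0) (Var 3)) (Var 1))
            (Cond (rep_of (Var 0) (Var 3)) (Lit 1)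
              (Cond (Less (Add (count_of (Var 2) (Var 1)) (count_of (Var 2) (Var 0)))
                          (lbd_of (Var 0) (Var 3)))
                MkLeaf (Lit 1)))
            (Lit 1)))
        MkLeaf),
    \<comment> \<open>p_move [pos, v, w]\<close>
    loop p_move [Var 1, Var 2]
      (MkNode
        (Cond (First (Var 1))
          (Cond (is_eq (First (Var 1)) (Var 2)) (Var 3) (First (Var 1))) MkLeaf)
        (Var 0))
      MkLeaf,
    \<comment> \<open>p_sort [vs, c]\<close>
    loop p_sort [Var 1] (Call p_insert [Var 0, First (Var 1), Var 2]) MkLeaf,
    \<comment> \<open>p_insert [vs, v, c]\<close>
    loop p_insert [Var 1, Var 2]
      (Cond (Call p_key_le [Var 2, First (Var 1), Var 3])
        (MkNode (Var 2) (Var 1)) (MkNode (First (Var 1)) (Var 0)))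
      (MkNode (Var 1) MkLeaf),
    \<comment> \<open>p_key_le [v, w, c]\<close>
    Cond (Less (Call p_ell [Var 0, Var 2]) (Call p_ell [Var 1, Var 2])) (Lit 1)
      (Cond (Less (Call p_ell [Var 1, Var 2]) (Call p_ell [Var 0, Var 2])) MkLeaf
        (Cond (Less (Add (Var 1) (nx_of (Var 1) (Var 2))) (Add (Var 0) (nx_of (Var 0) (Var 2))))
          MkLeaf (Lit 1))),
    \<comment> \<open>p_rep [v, c]\<close>
    Call p_find [get_S (Var 1), Var 0, Var 1],
    \<comment> \<open>p_find [xs, v, c]\<close>
    loop p_find [Var 1, Var 2]
      (Cond (Call p_in [Var 2, First (Var 1), Var 3]) (First (Var 1)) (Var 0))
      MkLeaf,
    \<comment> \<open>p_in [v, i, c]\<close>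
    Bind (dist_of (Var 0) (Var 1) (Var 2))
      (Less (Add (Var 0) (Var 0)) (Call p_ell [Var 1, Var 3])),
    \<comment> \<open>p_ell [v, c]\<close>
    dist_of (Var 0) (nx_of (Var 0) (Var 1)) (Var 1),
    \<comment> \<open>p_nx [xs, v, c]\<close>
    loop p_nx [Var 1, Var 2]
      (Cond (is_eq (First (Var 1)) (Var 2)) (Var 0)
        (Cond (Var 0)
          (Cond (Less (dist_of (Var 2) (Var 0) (Var 3)) (dist_of (Var 2) (First (Var 1)) (Var 3)))
            (Var 0) (First (Var 1)))
          (First (Var 1))))
      MkLeaf,
    \<comment> \<open>p_dist [v, i, c]\<close>
    look (get_facs (Var 2)) (look (get_facs (Var 2)) (get_dst (Var 2)) (Var 0)) (Var 1),
    \<comment> \<open>p_lbd [v, c]\<close>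
    look (get_facs (Var 1)) (get_lbd (Var 1)) (Var 0),
    \<comment> \<open>p_count [pos, v]\<close>
    loop p_count [Var 1]
      (Cond (First (Var 1))
        (Cond (is_eq (First (Var 1)) (Var 2)) (Add (Var 0) (Lit 1)) (Var 0)) (Var 0))
      (Lit 0),
    \<comment> \<open>p_mem [xs, x]\<close>
    loop p_mem [Var 1] (Cond (is_eq (First (Var 1)) (Var 2)) (Lit 1) (Var 0)) MkLeaf,
    \<comment> \<open>p_look [keys, vals, x]\<close>
    loop p_look [Second (Var 1), Var 2]
      (Cond (is_eq (First (Var 1)) (Var 3)) (First (Var 2)) (Var 0))
      MkLeaf,
    \<comment> \<open>p_eq [x, y]\<close>
    Cond (Less (Var 0) (Var 1)) MkLeaf (Cond (Less (Var 1) (Var 0)) MkLeaf (Lit 1))]"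

lemma length_prog: "length prog = 27"
  by (simp add: prog_def)

section \<open>The call structure of the program\<close>

fun well_formed_from :: "nat \<Rightarrow> nat \<Rightarrow> expr list \<Rightarrow> bool" where
  "well_formed_from n k [] = True"
| "well_formed_from n k (b # bs) = (well_formed n k b \<and> well_formed_from n (k + 1) bs)"

lemma well_formed_from_nth:
  "well_formed_from n k bs \<Longrightarrow> i < length bs \<Longrightarrow> well_formed n (k + i) (bs ! i)"
proof (induction bs arbitrary: k i)
  case (Cons b bs)
  then show ?case using Cons.IH[of "k + 1" "i - 1"] by (cases i) auto
qed simp

lemma well_formed_plain: "callees b \<subseteq> {k<..<n} \<Longrightarrow> well_formed n k b"
  unfolding well_formed_def by blast

lemma well_formed_loop:
  "callees step \<subseteq> {k<..<n} \<Longrightarrow> callees base \<subseteq> {k<..<n} \<Longrightarrow> (\<forall>e\<in>set es. callees e = {}) \<Longrightarrow>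
    well_formed n k (loop k es step base)"
  unfolding well_formed_def by blast

lemma well_formed_prog: "k < 27 \<Longrightarrow> well_formed 27 k (prog ! k)"
proof -
  have "well_formed_from 27 0 prog" unfolding prog_def
    by (simp only: well_formed_from.simps add_0 one_add_one numeral_plus_one add_num_simps simp_thms)
      (intro conjI; ((rule well_formed_loop; simp; fail) | (rule well_formed_plain; simp; fail)))
  then show "k < 27 \<Longrightarrow> well_formed 27 k (prog ! k)"
    using well_formed_from_nth[of 27 0 prog k] by (simp add: length_prog)
qed

lemma terminates_prog: "k < 27 \<Longrightarrow> terminates prog k"
  by (rule terminates_well_formed) (simp_all add: length_prog well_formed_prog)

lemma terminates_callees: "k < 27 \<Longrightarrow> l \<in> callees (prog ! k) \<Longrightarrow> terminates prog l"
  using callees_well_formed[OF well_formed_prog] terminates_prog by fastforce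

lemmas body_main = arg_cong[OF prog_def, of "\<lambda>p. p ! p_main", simplified]
lemmas body_open = arg_cong[OF prog_def, of "\<lambda>p. p ! p_open", simplified]
lemmas body_is_open = arg_cong[OF prog_def, of "\<lambda>p. p ! p_is_open", simplified]
lemmas body_assign = arg_cong[OF prog_def, of "\<lambda>p. p ! p_assign", simplified]
lemmas body_assign_client = arg_cong[OF prog_def, of "\<lambda>p. p ! p_assign_client", simplified]
lemmas body_target = arg_cong[OF prog_def, of "\<lambda>p. p ! p_target", simplified]
lemmas body_near = arg_cong[OF prog_def, of "\<lambda>p. p ! p_near", simplified]
lemmas body_phi = arg_cong[OF prog_def, of "\<lambda>p. p ! p_phi", simplified]
lemmas body_start = arg_cong[OF prog_def, of "\<lambda>p. p ! p_start", simplified]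
lemmas body_run = arg_cong[OF prog_def, of "\<lambda>p. p ! p_run", simplified]
lemmas body_route = arg_cong[OF prog_def, of "\<lambda>p. p ! p_route", simplified]
lemmas body_ships = arg_cong[OF prog_def, of "\<lambda>p. p ! p_ships", simplified]
lemmas body_move = arg_cong[OF prog_def, of "\<lambda>p. p ! p_move", simplified]
lemmas body_sort = arg_cong[OF prog_def, of "\<lambda>p. p ! p_sort", simplified]
lemmas body_insert = arg_cong[OF prog_def, of "\<lambda>p. p ! p_insert", simplified]
lemmas body_key_le = arg_cong[OF prog_def, of "\<lambda>p. p ! p_key_le", simplified]
lemmas body_rep = arg_cong[OF prog_def, of "\<lambda>p. p ! p_rep", simplified]
lemmas body_find = arg_cong[OF prog_def, of "\<lambda>p. p ! p_find", simplified]
lemmas body_in = arg_cong[OF prog_def, of "\<lambda>p. p ! p_in", simplified]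
lemmas body_ell = arg_cong[OF prog_def, of "\<lambda>p. p ! p_ell", simplified]
lemmas body_nx = arg_cong[OF prog_def, of "\<lambda>p. p ! p_nx", simplified]
lemmas body_dist = arg_cong[OF prog_def, of "\<lambda>p. p ! p_dist", simplified]
lemmas body_lbd = arg_cong[OF prog_def, of "\<lambda>p. p ! p_lbd", simplified]
lemmas body_count = arg_cong[OF prog_def, of "\<lambda>p. p ! p_count", simplified]
lemmas body_mem = arg_cong[OF prog_def, of "\<lambda>p. p ! p_mem", simplified]
lemmas body_look = arg_cong[OF prog_def, of "\<lambda>p. p ! p_look", simplified]
lemmas body_eq = arg_cong[OF prog_def, of "\<lambda>p. p ! p_eq", simplified]

lemma length_le_cells: "length xs \<le> cells (enc_list xs)"
  by (induction xs) auto

lemma cells_first: "cells (first v) \<le> cells v" and cells_second: "cells (second v) \<le> cells v"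
  by (cases v; simp)+

text \<open>The number 0 is encoded as \<open>Num 0\<close>, which \<open>Cond\<close> takes as
  true; so \<open>Leaf\<close> can stand for an absent facility.\<close>

lemma num_enc_nat [simp]: "num (enc_nat n) = real n" and enc_nat_neq [simp]: "enc_nat n \<noteq> Leaf"
  by (simp_all add: enc_nat_def)

lemma enc_option_eq_Leaf [simp]: "enc_option o' = Leaf \<longleftrightarrow> o' = None"
  by (cases o') auto

definition enc_bool :: "bool \<Rightarrow> val" where
  "enc_bool b = (if b then Num 1 else Leaf)"

lemma enc_bool_simps [simp]: "enc_bool True = Num 1" "enc_bool False = Leaf" "enc_bool b = Leaf \<longleftrightarrow> \<not> b"
  by (auto simp: enc_bool_def)

section \<open>Values and running times of the functions\<close>

context penalty_solution
begin

definition ctx :: val where "ctx = enc_input I \<beta> S0 s0 S \<sigma>"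

abbreviation "call k \<equiv> fval prog k"
abbreviation "in_time k as \<equiv> fcst prog k as \<le> bound prog (cells ctx) k"
abbreviation "rounds k as r \<equiv> fcst prog k as \<le> r * round_bound prog (cells ctx) k"
abbreviation "calls_in_time k \<rho> e \<equiv> \<forall>(l, as)\<in>calls (fval prog) \<rho> e. k < l \<and> in_time l as"
abbreviation "enc_nats xs \<equiv> enc_list (map enc_nat xs)"

abbreviation "Fs \<equiv> sorted_list_of_set (facs I)"
abbreviation "Cs \<equiv> sorted_list_of_set (clis I)"
abbreviation "Vs \<equiv> sorted_list_of_set S0"
abbreviation "Ss \<equiv> sorted_list_of_set S"

lemma ctx_simps [simp]:
  "first (first ctx) = enc_nats Fs"
  "first (second (first ctx)) = enc_nats Cs"
  "first (second (second (first ctx))) =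
     enc_list (map (\<lambda>x. enc_list (map (\<lambda>y. Num (dst I x y)) (points I))) (points I))"
  "first (second (second (second (second (first ctx))))) = enc_list (map (\<lambda>i. enc_nat (lbd I i)) Fs)"
  "first (second (second ctx)) = enc_nats Vs"
  "first (second (second (second ctx))) = enc_list (map (\<lambda>j. enc_nat (s0 j)) Cs)"
  "first (second (second (second (second ctx)))) = enc_nats Ss"
  "first (second (second (second (second (second ctx))))) = enc_list (map (\<lambda>j. enc_option (\<sigma> j)) Cs)"
  by (simp_all add: ctx_def enc_input_def enc_lbfl_def enc_set_def enc_fun_def)

lemma lengths:
  "length Fs \<le> cells ctx" "length Cs \<le> cells ctx" "length Vs \<le> cells ctx" "length Ss \<le> cells ctx"
proof -
  show "length Fs \<le> cells ctx"
    using length_le_cells[of "map enc_nat Fs"] cells_first[of "first ctx"] cells_first[of ctx]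
    by (simp del: length_sorted_list_of_set)
  show "length Cs \<le> cells ctx"
    using length_le_cells[of "map enc_nat Cs"] cells_first[of "second (first ctx)"]
      cells_second[of "first ctx"] cells_first[of ctx]
    by (simp del: length_sorted_list_of_set)
  show "length Vs \<le> cells ctx"
    using length_le_cells[of "map enc_nat Vs"] cells_first[of "second (second ctx)"]
      cells_second[of "second ctx"] cells_second[of ctx]
    by (simp del: length_sorted_list_of_set)
  show "length Ss \<le> cells ctx"
    using length_le_cells[of "map enc_nat Ss"] cells_first[of "second (second (second (second ctx)))"]
      cells_second[of "second (second (second ctx))"] cells_second[of "second (second ctx)"]
      cells_second[of "second ctx"] cells_second[of ctx]
    by (simp del: length_sorted_list_of_set)
qed

text \<open>Value and time are handled together: which calls are made, and with which arguments,
  depends on the values computed before.\<close>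

lemma nonrec_spec:
  assumes "prog ! k = e" "k < 27" "fden prog \<rho> e = v" "calls_in_time k \<rho> e"
  shows "call k \<rho> = v \<and> in_time k \<rho>"
  using call_unfold(1)[of prog k \<rho>] fcst_nonrec[of prog k \<rho> "cells ctx"] assms
    terminates_prog terminates_callees by simp

text \<open>The parameters \<open>ps\<close> are passed on unchanged, so value and time follow by
  induction on the list, with \<open>Q\<close> any condition inherited by tails. The
  \<open>length xs + 1\<close> rounds, one of them for the empty list, fit the factor in
  \<open>bound\<close>.\<close>

lemma loop_spec:
  assumes body: "prog ! k = loop k es step base" "k < 27"
    and es: "\<And>e. e \<in> set es \<Longrightarrow> callees e = {}" "\<And>e \<rho>. e \<in> set es \<Longrightarrow> calls (fval prog) \<rho> e = {}"
      "\<And>v. map (fden prog (v # ps)) es = ps"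
    and base: "fden prog (Leaf # ps) base = g []" "calls_in_time k (Leaf # ps) base"
    and Q: "\<And>x xs. Q (x # xs) \<Longrightarrow> Q xs"
    and step: "\<And>x xs. Q (x # xs) \<Longrightarrow>
        fden prog (g xs # Node (e x) (enc_list (map e xs)) # ps) step = g (x # xs)"
      "\<And>x xs. Q (x # xs) \<Longrightarrow> calls_in_time k (g xs # Node (e x) (enc_list (map e xs)) # ps) step"
    and xs: "Q xs" "length xs \<le> cells ctx"
  shows "call k (enc_list (map e xs) # ps) = g xs \<and> in_time k (enc_list (map e xs) # ps)"
proof -
  note P = body(1) terminates_prog[OF body(2)] terminates_callees[OF body(2)]
  have "call k (enc_list (map e xs) # ps) = g xs \<and> rounds k (enc_list (map e xs) # ps) (length xs + 1)"
    using xs(1)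
  proof (induction xs)
    case Nil
    then show ?case
      using fval_loop(1)[OF P] fcst_loop(1)[OF P es(1,2)] base by simp
  next
    case (Cons x xs)
    then have IH: "call k (enc_list (map e xs) # ps) = g xs"
        "rounds k (enc_list (map e xs) # ps) (length xs + 1)"
      using Q by auto
    show ?case
      using fval_loop(2)[OF P, of "e x" "enc_list (map e xs)" ps]
        fcst_loop(2)[OF P es(1,2), where n = "cells ctx" and xs = "enc_list (map e xs)" and x = "e x" and ps = ps] step[OF Cons.prems] IH
      by (simp add: es(3))
  qed
  moreover have "(length xs + 1) * round_bound prog (cells ctx) k \<le> bound prog (cells ctx) k"
    using bound_round[of k prog "cells ctx"] body(2) xs(2) by (simp add: length_prog)
  ultimately show ?thesis by linarith
qed

lemma eq_spec [simp]:
  "call p_eq [v, w] = enc_bool (num v = num w) \<and> in_time p_eq [v, w]"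
  by (rule nonrec_spec[OF body_eq]) auto

text \<open>\<open>p_look\<close> walks through keys and values at once, so its parameters change
  from round to round and it gets an induction of its own. The list \<open>rest\<close> absorbs the
  entries of the clients, which follow those of the facilities in \<open>points\<close>.\<close>

lemma look_spec:
  assumes "x \<in> set ks" "length ks \<le> cells ctx"
  shows "call p_look [enc_nats ks, enc_list (map g ks @ rest), enc_nat x] = g x \<and>
    in_time p_look [enc_nats ks, enc_list (map g ks @ rest), enc_nat x]"
proof -
  have P: "p_look < 27" by simp
  note P = body_look terminates_prog[OF P] terminates_callees[OF P]
  have es: "callees e = {}" "calls (fval prog) \<rho> e = {}"
    if "e \<in> set [Second (Var (Suc 0)), Var 2]" for e \<rho>
    using that by auto
  have "(x \<in> set ks \<longrightarrow> call p_look [enc_nats ks, enc_list (map g ks @ rest), enc_nat x] = g x) \<and>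
      rounds p_look [enc_nats ks, enc_list (map g ks @ rest), enc_nat x] (length ks + 1)"
  proof (induction ks)
    case Nil
    then show ?case using fcst_loop(1)[OF P es] by simp
  next
    case (Cons k ks)
    then show ?case
      using fval_loop(2)[OF P, of "enc_nat k" "enc_nats ks" "[enc_list (map g (k # ks) @ rest), enc_nat x]"]
        fcst_loop(2)[OF P es, where n = "cells ctx" and xs = "enc_nats ks" and x = "enc_nat k"
          and ps = "[enc_list (map g (k # ks) @ rest), enc_nat x]"]
      by auto
  qed
  moreover have "(length ks + 1) * round_bound prog (cells ctx) p_look \<le> bound prog (cells ctx) p_look"
    using bound_round[of p_look prog "cells ctx"] assms(2) by (simp add: length_prog)
  ultimately show ?thesis using assms(1) by auto
qed

lemmas look_map_spec = look_spec[of _ _ _ "[]", unfolded append_Nil2]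

lemma lbd_spec [simp]:
  assumes "v \<in> facs I"
  shows "call p_lbd [enc_nat v, ctx] = enc_nat (lbd I v) \<and> in_time p_lbd [enc_nat v, ctx]"
  by (rule nonrec_spec[OF body_lbd]) (use assms inst(1) lengths(1) in \<open>simp_all add: look_map_spec\<close>)

lemma dist_spec [simp]:
  assumes "v \<in> facs I" "i \<in> facs I"
  shows "call p_dist [enc_nat v, enc_nat i, ctx] = Num (dd v i) \<and> in_time p_dist [enc_nat v, enc_nat i, ctx]"
proof -
  have mem: "v \<in> set Fs" "i \<in> set Fs" using assms inst(1) by auto
  define row where "row x = enc_list (map (\<lambda>y. Num (dst I x y)) (points I))" for x
  have "map row (points I) = map (\<lambda>x. row (Inl x)) Fs @ map row (map Inr Cs)"
    by (simp add: points_def)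
  with look_spec[OF mem(1) lengths(1), of "\<lambda>x. row (Inl x)" "map row (map Inr Cs)"]
  have 1: "call p_look [enc_nats Fs, enc_list (map row (points I)), enc_nat v] = row (Inl v)"
    "in_time p_look [enc_nats Fs, enc_list (map row (points I)), enc_nat v]" by simp_all
  have "row (Inl v) = enc_list (map (\<lambda>y. Num (dd v y)) Fs @ map (\<lambda>y. Num (dst I (Inl v) y)) (map Inr Cs))"
    by (simp add: row_def points_def comp_def)
  with look_spec[OF mem(2) lengths(1), of "\<lambda>y. Num (dd v y)" "map (\<lambda>y. Num (dst I (Inl v) y)) (map Inr Cs)"]
  have 2: "call p_look [enc_nats Fs, row (Inl v), enc_nat i] = Num (dd v i)"
    "in_time p_look [enc_nats Fs, row (Inl v), enc_nat i]" by simp_all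
  show ?thesis
    by (rule nonrec_spec[OF body_dist]) (use 1 2 in \<open>simp_all add: row_def[symmetric]\<close>)
qed

lemma nx_loop_spec:
  assumes "v \<in> S0" "set xs \<subseteq> S0" "length xs \<le> cells ctx"
  shows "call p_nx [enc_nats xs, enc_nat v, ctx] =
      enc_option (leftmost_min (dd v) (filter (\<lambda>x. x \<noteq> v) xs)) \<and>
    in_time p_nx [enc_nats xs, enc_nat v, ctx]"
proof (rule loop_spec[OF body_nx,
      where g = "\<lambda>xs. enc_option (leftmost_min (dd v) (filter (\<lambda>x. x \<noteq> v) xs))"
        and Q = "\<lambda>xs. set xs \<subseteq> S0"], goal_cases)
  \<comment> \<open>Goals 8 and 9 are the value and the time of one step. The minimiser found so far
    lies in \<open>xs\<close>, so it is a facility and \<open>dist_spec\<close> applies to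
    it.\<close>
  case (8 x xs)
  then have x: "v \<in> facs I" "x \<in> facs I" "set xs \<subseteq> facs I" using assms(1) S0(1) by auto
  with leftmost_min_Some(1)[of "dd v" "filter (\<lambda>x. x \<noteq> v) xs"] show ?case
    by (cases "leftmost_min (dd v) (filter (\<lambda>x. x \<noteq> v) xs)") auto
next
  case (9 x xs)
  then have x: "v \<in> facs I" "x \<in> facs I" "set xs \<subseteq> facs I" using assms(1) S0(1) by auto
  with leftmost_min_Some(1)[of "dd v" "filter (\<lambda>x. x \<noteq> v) xs"] show ?case
    by (cases "leftmost_min (dd v) (filter (\<lambda>x. x \<noteq> v) xs)") auto
qed (use assms in auto)

lemma S0_facs: "v \<in> S0 \<Longrightarrow> v \<in> facs I"
  using S0(1) by auto

lemma nx_spec [simp]: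
  assumes "v \<in> S0"
  shows "call p_nx [enc_nats Vs, enc_nat v, ctx] = enc_nat (nx v) \<and>
    in_time p_nx [enc_nats Vs, enc_nat v, ctx]"
  using nx_loop_spec[OF assms, of Vs] lengths(3) nx_Some[OF assms] by simp

lemma ell_spec [simp]:
  assumes "v \<in> S0"
  shows "call p_ell [enc_nat v, ctx] = Num (\<l> v) \<and> in_time p_ell [enc_nat v, ctx]"
  by (rule nonrec_spec[OF body_ell]) (use assms nx(1)[OF assms] S0_facs ell_nx in simp_all)

text \<open>The machine has no division, so the program compares twice the distance with
  \<open>\<l> v\<close>.\<close>

lemma in_spec [simp]:
  assumes "v \<in> S0" "i \<in> facs I"
  shows "call p_in [enc_nat v, enc_nat i, ctx] = enc_bool (i \<in> N v) \<and>
    in_time p_in [enc_nat v, enc_nat i, ctx]"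
  by (rule nonrec_spec[OF body_in]) (use assms S0_facs in \<open>auto simp: nbhd_def enc_bool_def\<close>)

lemma find_spec:
  assumes "v \<in> S0" "set xs \<subseteq> facs I" "length xs \<le> cells ctx"
  shows "call p_find [enc_nats xs, enc_nat v, ctx] = enc_option (List.find (\<lambda>i. i \<in> N v) xs) \<and>
    in_time p_find [enc_nats xs, enc_nat v, ctx]"
  by (rule loop_spec[OF body_find, where g = "\<lambda>xs. enc_option (List.find (\<lambda>i. i \<in> N v) xs)"
        and Q = "\<lambda>xs. set xs \<subseteq> facs I"]) (use assms in auto)

lemma rep_spec [simp]:
  assumes "v \<in> S0"
  shows "call p_rep [enc_nat v, ctx] = enc_option (rep v) \<and> in_time p_rep [enc_nat v, ctx]"
  by (rule nonrec_spec[OF body_rep])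
    (use find_spec[OF assms, of Ss] lengths(4) S(1) in \<open>simp_all add: rep_def\<close>)

lemma phi_spec [simp]:
  assumes "i \<in> facs I"
  shows "call p_phi [enc_nats Vs, enc_nat i, ctx] = enc_nat (\<phi> i) \<and>
    in_time p_phi [enc_nats Vs, enc_nat i, ctx]"
proof -
  let ?g = "\<lambda>xs. enc_nat (case List.find (\<lambda>v. i \<in> N v) xs of None \<Rightarrow> i | Some v \<Rightarrow> v)"
  have "call p_phi [enc_nats Vs, enc_nat i, ctx] = ?g Vs \<and> in_time p_phi [enc_nats Vs, enc_nat i, ctx]"
    by (rule loop_spec[OF body_phi, where g = ?g and Q = "\<lambda>xs. set xs \<subseteq> S0"])
      (use assms lengths(3) in auto)
  moreover have "(case List.find (\<lambda>v. i \<in> N v) Vs of None \<Rightarrow> i | Some v \<Rightarrow> v) = \<phi> i"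
  proof (cases "List.find (\<lambda>v. i \<in> N v) Vs")
    case None
    then have "\<phi> i = i" by (intro phi_other) (auto simp: find_None_iff)
    with None show ?thesis by simp
  next
    case (Some v)
    then have "v \<in> S0" "i \<in> N v" by (metis find_Some_iff nth_mem set_sorted_list_of_set finite_S0)+
    then show ?thesis using Some phi_nbhd by simp
  qed
  ultimately show ?thesis by simp
qed

lemma near_spec:
  assumes "v \<in> S0" "S \<noteq> {}"
  shows "call p_near [enc_nats Ss, enc_nat v, ctx] = enc_nat (near v) \<and>
    in_time p_near [enc_nats Ss, enc_nat v, ctx]"
proof -
  let ?m = "leftmost_min (\<lambda>i. dd v (\<phi> i))"
  have "call p_near [enc_nats Ss, enc_nat v, ctx] = enc_option (?m Ss) \<and>
    in_time p_near [enc_nats Ss, enc_nat v, ctx]"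
  proof (rule loop_spec[OF body_near, where g = "\<lambda>xs. enc_option (?m xs)"
        and Q = "\<lambda>xs. set xs \<subseteq> S"], goal_cases)
    case (8 x xs)
    then have x: "v \<in> facs I" "x \<in> facs I" "set xs \<subseteq> facs I" using assms(1) S0(1) S(1) by auto
    with leftmost_min_Some(1)[of "\<lambda>i. dd v (\<phi> i)" xs] show ?case
      by (cases "?m xs") (auto simp: phi_in)
  next
    case (9 x xs)
    then have x: "v \<in> facs I" "x \<in> facs I" "set xs \<subseteq> facs I" using assms(1) S0(1) S(1) by auto
    with leftmost_min_Some(1)[of "\<lambda>i. dd v (\<phi> i)" xs] show ?case
      by (cases "?m xs") (auto simp: phi_in)
  qed (use lengths(4) in auto)
  moreover have "?m Ss = Some (near v)" unfolding near_def
    using assms(2) by (metis finite_S leftmost_min_eq_None option.collapse sorted_list_of_set_eq_Nil_iff)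
  ultimately show ?thesis by simp
qed

text \<open>The rule not_None_eq would rewrite the parameter rep v \<noteq> None inside the constants of the
  locale routing, so that their defining equations no longer match.\<close>

declare not_None_eq [simp del]

definition position :: "(nat \<Rightarrow> nat) \<Rightarrow> nat \<Rightarrow> val" where
  "position q j = (if \<sigma> j = None then enc_nat (q j) else Leaf)"

abbreviation "positions q \<equiv> enc_list (map (position q) Cs)"

lemma count_spec [simp]:
  "call p_count [positions q, enc_nat v] = enc_nat (cnt q v) \<and> in_time p_count [positions q, enc_nat v]"
proof -
  let ?P = "\<lambda>j. \<sigma> j = None \<and> q j = v"
  have "call p_count [positions q, enc_nat v] = Num (length (filter ?P Cs)) \<and>
    in_time p_count [positions q, enc_nat v]"
    by (rule loop_spec[OF body_count, where g = "\<lambda>xs. Num (length (filter ?P xs))" and Q = "\<lambda>_. True"])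
      (use lengths(2) in \<open>auto simp: position_def\<close>)
  moreover have "length (filter ?P Cs) = cnt q v"
  proof -
    have "{j. ?P j} \<inter> set Cs = {j \<in> unconnected. q j = v}"
      using inst(2) unfolding unconnected_def by auto
    then show ?thesis by (simp add: distinct_length_filter cnt_def)
  qed
  ultimately show ?thesis by (simp add: enc_nat_def)
qed

lemma move_spec [simp]:
  "call p_move [positions q, enc_nat v, enc_nat w] = positions (\<lambda>j. if q j = v then w else q j) \<and>
    in_time p_move [positions q, enc_nat v, enc_nat w]"
  by (rule loop_spec[OF body_move, where g = "\<lambda>xs. enc_list (map (position (\<lambda>j. if q j = v then w else q j)) xs)"
        and Q = "\<lambda>_. True"]) (use lengths(2) in \<open>auto simp: position_def\<close>)

lemma ships_spec [simp]:
  assumes "v \<in> S0"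
  shows "call p_ships [enc_nat v, positions q, ctx] = enc_bool (ships q v) \<and>
    in_time p_ships [enc_nat v, positions q, ctx]"
  by (rule nonrec_spec[OF body_ships])
    (use assms nx(1)[OF assms] nx(1)[OF nx(1)[OF assms]] S0_facs in \<open>auto simp: ships_def enc_bool_def\<close>)

lemma route_spec [simp]:
  assumes "v \<in> S0"
  shows "call p_route [enc_nat v, positions q, ctx] = positions (route v q) \<and>
    in_time p_route [enc_nat v, positions q, ctx]"
  by (rule nonrec_spec[OF body_route]) (use assms in \<open>simp_all add: route_def\<close>)

lemma run_spec:
  assumes "set vs \<subseteq> S0" "length vs \<le> cells ctx"
  shows "call p_run [enc_nats vs, positions q, ctx] = positions (foldr route vs q) \<and>
    in_time p_run [enc_nats vs, positions q, ctx]"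
  by (rule loop_spec[OF body_run, where g = "\<lambda>vs. positions (foldr route vs q)"
        and Q = "\<lambda>vs. set vs \<subseteq> S0"]) (use assms in auto)

lemma key_le_spec [simp]:
  assumes "v \<in> S0" "w \<in> S0"
  shows "call p_key_le [enc_nat v, enc_nat w, ctx] = enc_bool (key v \<le> key w) \<and>
    in_time p_key_le [enc_nat v, enc_nat w, ctx]"
  by (rule nonrec_spec[OF body_key_le]) (use assms in \<open>auto simp: key_def enc_bool_def\<close>)

lemma insert_spec:
  assumes "v \<in> S0" "set vs \<subseteq> S0" "length vs \<le> cells ctx"
  shows "call p_insert [enc_nats vs, enc_nat v, ctx] = enc_nats (insort_key key v vs) \<and>
    in_time p_insert [enc_nats vs, enc_nat v, ctx]"
  by (rule loop_spec[OF body_insert, where g = "\<lambda>vs. enc_nats (insort_key key v vs)"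
        and Q = "\<lambda>vs. set vs \<subseteq> S0"]) (use assms in auto)

lemma sort_spec:
  assumes "set vs \<subseteq> S0" "length vs \<le> cells ctx"
  shows "call p_sort [enc_nats vs, ctx] = enc_nats (sort_key key vs) \<and>
    in_time p_sort [enc_nats vs, ctx]"
  by (rule loop_spec[OF body_sort, where g = "\<lambda>vs. enc_nats (sort_key key vs)"
        and Q = "\<lambda>vs. set vs \<subseteq> S0 \<and> length vs \<le> cells ctx"]) (use assms in \<open>auto simp: insert_spec\<close>)

lemma look_client [simp]:
  assumes "j \<in> clis I"
  shows "call p_look [enc_nats Cs, enc_list (map g Cs), enc_nat j] = g j \<and>
    in_time p_look [enc_nats Cs, enc_list (map g Cs), enc_nat j]"
  using look_map_spec[of j Cs g] lengths(2) inst(2) assms by simp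

lemma start_spec [simp]:
  "call p_start [enc_nats Cs, ctx] = positions s0 \<and> in_time p_start [enc_nats Cs, ctx]"
  by (rule loop_spec[OF body_start, where g = "\<lambda>xs. enc_list (map (position s0) xs)"
        and Q = "\<lambda>xs. set xs \<subseteq> clis I"]) (use lengths(2) inst(2) in \<open>auto simp: position_def\<close>)

lemma target_spec [simp]:
  assumes "j \<in> unconnected"
  shows "call p_target [enc_nat (final j), positions final, ctx] = enc_nat (target (final j)) \<and>
    in_time p_target [enc_nat (final j), positions final, ctx]"
proof -
  let ?v = "final j"
  have v: "?v \<in> S0" by (rule final_in[OF assms])
  have "0 < cnt final ?v" using assms unfolding cnt_def by (auto simp: card_gt_0_iff)
  \<comment> \<open>\<open>p_near\<close> is called only at a pending facility, and there
    \<open>near_bound\<close> makes \<open>S\<close> nonempty.\<close>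
  then have "S \<noteq> {}" if "rep ?v = None" "cnt final ?v < lbd I ?v"
    using that v near_bound(1)[of ?v] unfolding pending_def by auto
  with near_spec[OF v] show ?thesis
    by (intro nonrec_spec[OF body_target]; cases "rep ?v") (use v S0_facs in \<open>auto simp: target_def\<close>)
qed

lemma assign_client_spec [simp]:
  assumes "j \<in> clis I"
  shows "call p_assign_client [enc_nat j, positions final, ctx] = enc_nat (assignment j) \<and>
    in_time p_assign_client [enc_nat j, positions final, ctx]"
proof (cases "\<sigma> j")
  case None
  then have "j \<in> unconnected" using assms unfolding unconnected_def by simp
  with None show ?thesis
    by (intro nonrec_spec[OF body_assign_client]) (use assms in \<open>auto simp: position_def assignment_def\<close>)
next
  case (Some i)
  then show ?thesis
    by (intro nonrec_spec[OF body_assign_client]) (use assms in \<open>auto simp: assignment_def\<close>)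
qed

lemma assign_spec [simp]:
  "call p_assign [enc_nats Cs, positions final, ctx] = enc_list (map (\<lambda>j. enc_nat (assignment j)) Cs) \<and>
    in_time p_assign [enc_nats Cs, positions final, ctx]"
  by (rule loop_spec[OF body_assign, where g = "\<lambda>xs. enc_list (map (\<lambda>j. enc_nat (assignment j)) xs)"
        and Q = "\<lambda>xs. set xs \<subseteq> clis I"]) (use lengths(2) inst(2) in auto)

lemma mem_spec:
  assumes "length xs \<le> cells ctx"
  shows "call p_mem [enc_nats xs, enc_nat x] = enc_bool (x \<in> set xs) \<and>
    in_time p_mem [enc_nats xs, enc_nat x]"
  by (rule loop_spec[OF body_mem, where g = "\<lambda>xs. enc_bool (x \<in> set xs)" and Q = "\<lambda>_. True"])
    (use assms in auto)

lemma is_open_spec [simp]: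
  "call p_is_open [enc_nat x, positions final, ctx] = enc_bool (x \<in> S \<union> opened) \<and>
    in_time p_is_open [enc_nat x, positions final, ctx]"
  by (rule nonrec_spec[OF body_is_open])
    (use mem_spec[OF lengths(3)] mem_spec[OF lengths(4)] S0_facs in \<open>auto simp: opened_def enc_bool_def\<close>)

lemma open_spec:
  "call p_open [enc_nats Fs, positions final, ctx] = enc_nats (filter (\<lambda>x. x \<in> S \<union> opened) Fs) \<and>
    in_time p_open [enc_nats Fs, positions final, ctx]"
  unfolding One_nat_def
  by (rule loop_spec[OF body_open, where g = "\<lambda>xs. enc_nats (filter (\<lambda>x. x \<in> S \<union> opened) xs)"
        and Q = "\<lambda>_. True"]) (use lengths(1) in auto)

text \<open>The output has to be the sorted list prescribed by \<open>enc_set\<close>, and filtering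
  the sorted list of facilities produces it.\<close>

lemma filter_open: "filter (\<lambda>x. x \<in> S \<union> opened) Fs = sorted_list_of_set (S \<union> opened)"
proof (rule sorted_distinct_set_unique)
  have "S \<union> opened \<subseteq> facs I" using S(1) S0(1) unfolding opened_def by auto
  moreover have "finite (S \<union> opened)" unfolding opened_def by simp
  ultimately show "set (filter (\<lambda>x. x \<in> S \<union> opened) Fs) = set (sorted_list_of_set (S \<union> opened))"
    using inst(1) by auto
qed (auto intro: sorted_wrt_filter)

lemma main_spec:
  "call p_main [ctx] = enc_solution I (S \<union> opened) assignment \<and> in_time p_main [ctx]"
proof -
  have sort: "call p_sort [enc_nats Vs, ctx] = enc_nats (sort_key key Vs)" "in_time p_sort [enc_nats Vs, ctx]"
    using sort_spec[of Vs] lengths(3) by simp_all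
  have run: "call p_run [enc_nats (sort_key key Vs), positions s0, ctx] = positions final"
      "in_time p_run [enc_nats (sort_key key Vs), positions s0, ctx]"
    using run_spec[of "sort_key key Vs" s0] lengths(3) by (simp_all add: final_def)
  show ?thesis
    by (rule nonrec_spec[OF body_main])
      (use sort run open_spec[unfolded filter_open] in \<open>simp_all add: enc_solution_def enc_set_def enc_fun_def\<close>)
qed

lemma runs_main: "\<exists>t \<le> bound prog (cells ctx) p_main. runs prog ctx (enc_solution I (S \<union> opened) assignment) t"
proof -
  have "evals prog [ctx] (prog ! p_main) (fden prog [ctx] (prog ! p_main)) (fsteps prog [ctx] (prog ! p_main))"
    by (rule evals_fden) (use terminates_callees[of p_main] in simp)
  moreover note call_unfold[of prog p_main "[ctx]"] terminates_prog[of p_main] terminates_callees[of p_main]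
  ultimately have "evals prog [ctx] (prog ! p_main) (call p_main [ctx]) (fcst prog p_main [ctx])" by simp
  then show ?thesis using main_spec length_prog unfolding runs_def by auto
qed

end

theorem theorem4:
  shows "\<exists>(P :: prog) (p :: nat poly).
    \<forall>(I :: (nat, nat) lbfl) (\<beta> :: real) (S0 :: nat set) (s0 :: nat \<Rightarrow> nat) (\<alpha>\<^sub>3 :: real)
      (S :: nat set) (\<sigma> :: nat \<Rightarrow> nat option).
      bicriteria_setting I \<beta> S0 s0 \<longrightarrow>
      approx_solution \<alpha>\<^sub>3 (lbflp_solutions (inst2 I S0 s0)) (cost3 I \<beta> S0 s0) (S, \<sigma>) \<longrightarrow>
      (\<exists>(S' :: nat set) (\<sigma>' :: nat \<Rightarrow> nat) (t :: nat).
         runs P (enc_input I \<beta> S0 s0 S \<sigma>) (enc_solution I S' \<sigma>') t \<and>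
         t \<le> poly p (cells (enc_input I \<beta> S0 s0 S \<sigma>)) \<and>
         approx_solution ((2 * \<beta> / (2 * \<beta> - 1) + 2 / \<beta>) * \<alpha>\<^sub>3)
           (lbfl_solutions (inst2 I S0 s0)) (lbfl_cost (inst2 I S0 s0)) (S', \<sigma>'))"
proof -
  \<comment> \<open>The bound depends on the program and the input size alone, so the polynomial is
    chosen before the instance.\<close>
  obtain p :: "nat poly" where p: "\<And>n. bound prog n p_main = poly p n"
    using polynomial_bound_bound[of prog p_main] unfolding polynomial_bound_def by blast
  show ?thesis
  proof (rule exI[of _ prog], rule exI[of _ p], intro allI impI)
    fix I :: "(nat, nat) lbfl" and \<beta> \<alpha>\<^sub>3 :: real and S0 S :: "nat set" and s0 :: "nat \<Rightarrow> nat"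
      and \<sigma> :: "nat \<Rightarrow> nat option"
    assume setting: "bicriteria_setting I \<beta> S0 s0"
      and approx: "approx_solution \<alpha>\<^sub>3 (lbflp_solutions (inst2 I S0 s0)) (cost3 I \<beta> S0 s0) (S, \<sigma>)"
    interpret penalty_solution I \<beta> S0 s0 S \<sigma>
      using setting approx by unfold_locales (auto simp: approx_solution_def)
    obtain t where "t \<le> poly p (cells ctx)" "runs prog ctx (enc_solution I (S \<union> opened) assignment) t"
      using runs_main p by auto
    then show "\<exists>(S' :: nat set) (\<sigma>' :: nat \<Rightarrow> nat) (t :: nat).
         runs prog (enc_input I \<beta> S0 s0 S \<sigma>) (enc_solution I S' \<sigma>') t \<and>
         t \<le> poly p (cells (enc_input I \<beta> S0 s0 S \<sigma>)) \<and>
         approx_solution ((2 * \<beta> / (2 * \<beta> - 1) + 2 / \<beta>) * \<alpha>\<^sub>3)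
           (lbfl_solutions (inst2 I S0 s0)) (lbfl_cost (inst2 I S0 s0)) (S', \<sigma>')"
      using approximation[OF setting approx] unfolding ctx_def by blast
  qed
qed

end
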